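(* Let $f(n)$ denote the number of graphical bipartite degree sequences on $n+n$ vertices, and assume that $f$ is a log-convex function of $n$. Then for every $\epsilon>0$ there exists a polynomial $\mathrm{poly}(n)$ such that $$\frac{f(n)}{g(n)}=O\big((1+\epsilon)^n\big),$$ where $g(n)$ denotes the number of graphical bipartite degree sequences on $n+n$ vertices for which the second largest eigenvalue $\lambda_2$ of their swap Markov chain satisfies $\frac{1}{1-\lambda_2}<\mathrm{poly}(n)$.
   Context: A bipartite degree sequence on $n+n$ vertices lists the degrees of two vertex classes, each of size $n$. It is graphical if a simple bipartite graph realizes it. The swap Markov chain is the lazy chain on the set of realizations: with probability $1/2$ it stays put; otherwise it proposes a swap, replacing edges $ac,bd$ by non-edges $bc,ad$, where $a,b$ are in one class and $c,d$ in the other, and accepts it if the result is a simple realization. $\lambda_2$ is the second largest eigenvalue of its transition matrix. *)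

theory Defs
  imports
    Complex_Main
    "HOL-Library.Countable_Set"
    "HOL-Library.Landau_Symbols"
    "Jordan_Normal_Form.Char_Poly"
begin

section \<open>Bipartite degree sequences\<close>

text \<open>
  Both vertex classes are labelled by \<open>{..<n}\<close>. A simple bipartite graph is its edge set, the pair
  \<open>(i, j)\<close> standing for the edge between vertex \<open>i\<close> of the first and vertex \<open>j\<close> of the second class.
  A degree sequence \<open>(d, e)\<close> lists the degrees of the vertices \<open>0, ..., n - 1\<close> of either class in
  this order; it need not be monotone, so rearranged sequences count as different.
\<close>

type_synonym bigraph = "(nat \<times> nat) set"
type_synonym bidegseq = "nat list \<times> nat list"

definition realizations :: "nat \<Rightarrow> bidegseq \<Rightarrow> bigraph set" where
  "realizations n D = {G. G \<subseteq> {..<n} \<times> {..<n} \<and>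
     (\<forall>i<n. card {j. (i, j) \<in> G} = fst D ! i) \<and>
     (\<forall>j<n. card {i. (i, j) \<in> G} = snd D ! j)}"

definition graphical :: "nat \<Rightarrow> bidegseq \<Rightarrow> bool" where
  "graphical n D \<longleftrightarrow>
     length (fst D) = n \<and> length (snd D) = n \<and> realizations n D \<noteq> {}"

definition num_graphical :: "nat \<Rightarrow> nat" where
  "num_graphical n = card {D. graphical n D}"

definition log_convex_seq :: "(nat \<Rightarrow> real) \<Rightarrow> bool" where
  "log_convex_seq f \<longleftrightarrow> (\<forall>n. 0 < f n) \<and> (\<forall>n. (f (Suc n))\<^sup>2 \<le> f n * f (Suc (Suc n)))"

section \<open>The swap Markov chain\<close>

text \<open>
  A proposal consists of two distinct vertices \<open>a, b\<close> of the first class and two distinct vertices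
  \<open>c, d\<close> of the second class, drawn uniformly at random as an ordered quadruple. (Choosing \<open>a, b\<close>
  in the second and \<open>c, d\<close> in the first class yields the same swaps.)
\<close>

definition proposals :: "nat \<Rightarrow> (nat \<times> nat \<times> nat \<times> nat) set" where
  "proposals n = {(a, b, c, d). a < n \<and> b < n \<and> c < n \<and> d < n \<and> a \<noteq> b \<and> c \<noteq> d}"

definition try_swap :: "bigraph \<Rightarrow> nat \<times> nat \<times> nat \<times> nat \<Rightarrow> bigraph" where
  "try_swap G = (\<lambda>(a, b, c, d).
     if (a, c) \<in> G \<and> (b, d) \<in> G \<and> (b, c) \<notin> G \<and> (a, d) \<notin> G
     then G - {(a, c), (b, d)} \<union> {(b, c), (a, d)} else G)"

text \<open>
  The probability of moving from \<open>G\<close> to \<open>H\<close> in one step. For \<open>n < 2\<close> there are no proposals and the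
  chain never moves.
\<close>

definition swap_prob :: "nat \<Rightarrow> bigraph \<Rightarrow> bigraph \<Rightarrow> real" where
  "swap_prob n G H =
     1 / 2 * of_bool (G = H) +
     1 / 2 * (if proposals n = {} then of_bool (G = H)
              else real (card {q \<in> proposals n. try_swap G q = H}) / real (card (proposals n)))"

text \<open>
  The state space is the set of realizations, enumerated by \<^const>\<open>from_nat_into\<close>. The choice of the
  enumeration does not affect the characteristic polynomial.
\<close>

definition swap_matrix :: "nat \<Rightarrow> bidegseq \<Rightarrow> real mat" where
  "swap_matrix n D = (let S = realizations n D in
     mat (card S) (card S) (\<lambda>(i, j). swap_prob n (from_nat_into S i) (from_nat_into S j)))"

text \<open>
  Real eigenvalues in decreasing order, repeated according to algebraic multiplicity. The transition
  matrix is symmetric, so all its eigenvalues appear here.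
\<close>

definition eigenvalues_desc :: "real mat \<Rightarrow> real list" where
  "eigenvalues_desc A = rev (sorted_list_of_multiset (proots (char_poly A)))"

definition lambda2 :: "nat \<Rightarrow> bidegseq \<Rightarrow> real" where
  "lambda2 n D = eigenvalues_desc (swap_matrix n D) ! 1"

text \<open>
  \<open>1 / (1 - \<lambda>\<^sub>2) < B\<close>, where two degenerate cases are excluded: a chain with a single state has no
  second eigenvalue, and for \<open>\<lambda>\<^sub>2 = 1\<close> the left-hand side is infinite (whereas \<open>1 / 0 = 0\<close> in HOL).
\<close>

definition relaxation_time_less :: "nat \<Rightarrow> bidegseq \<Rightarrow> real \<Rightarrow> bool" where
  "relaxation_time_less n D B \<longleftrightarrow>
     2 \<le> card (realizations n D) \<and> lambda2 n D < 1 \<and> 1 / (1 - lambda2 n D) < B"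

definition num_fast :: "real poly \<Rightarrow> nat \<Rightarrow> nat" where
  "num_fast p n = card {D. graphical n D \<and> relaxation_time_less n D (poly p (real n))}"

end

theory Submission
  imports Defs
begin

text \<open>
  Call a degree sequence on \<open>n + n\<close> vertices positive if all its degrees are positive. Placing a block
  \<open>(X\<^sub>1, Y\<^sub>1)\<close> above a block \<open>(X\<^sub>2, Y\<^sub>2)\<close>, with all pairs in \<open>X\<^sub>1 \<times> Y\<^sub>2\<close> joined and no pair in
  \<open>X\<^sub>2 \<times> Y\<^sub>1\<close> joined, composes positive sequences to positive sequences. The blocks can be recovered
  from the degrees, so the number of positive sequences divided by \<open>(n!)\<^sup>2\<close> is supermultiplicative.
  It is also at most \<open>exp (2 * n)\<close>, hence its \<open>n\<close>-th roots have a finite supremum \<open>L\<close>, and sequences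
  composed of blocks of a suitable fixed size \<open>k\<close> already attain the growth rate \<open>L / (1 + \<delta>)\<close>.

  The composed degrees force the pairs between different blocks, so the swap chain of a composed
  sequence is a product of the chains of its blocks. By Ryser's theorem every chain is irreducible,
  hence satisfies a Poincare inequality, and the constant of a product is the maximum of the constants
  of its factors. With blocks of bounded size this constant is bounded, and the proposal probabilities
  cost only a factor \<open>n\<^sup>4\<close>. One block of size 2 guarantees that the chain has two states.
\<close>

section \<open>The second eigenvalue of a symmetric stochastic matrix\<close>

text \<open>Three obstacles shape the details. (1) \<open>lambda2\<close> is entry 1 of a sorted
  list of real roots of a characteristic polynomial. So all roots must be shown to be real, one
  factor for the eigenvalue 1 must be split off, and the remaining roots must be bounded away from
  1. (2) The proposal probabilities depend on the total size \<open>n\<close>, so the transition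
  probabilities of a block differ from those of the same moves inside a composed sequence. The
  Poincare inequalities are therefore stated for the bare adjacency relation \<open>swap\<close>,
  and probabilities enter only once, at the end. (3) Blocks can be recovered only if their degrees
  are positive, whereas \<open>num_graphical\<close> also counts zero degrees. One additional vertex
  on each side, joined to everything opposite, makes all degrees positive, so all sequences of size
  \<open>n\<close> are bounded by the positive ones of size \<open>n + 1\<close>. The price is a
  factor of order (n+1)^2, which is subexponential. No explicit spectral estimate for a block is
  required: its size depends on \<epsilon> alone, so finitely many block sequences occur. The
  polynomial has degree 4 for every \<epsilon>, and only its leading coefficient varies.\<close>

text \<open>Rows summing to 1 make the all-ones vector an eigenvector, and in a basis containing it
  \<open>P\<close> becomes block triangular. Splitting off exactly one factor keeps track of
  multiplicity: a second root 1 would show up in the remaining block.\<close>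

lemma char_poly_stochastic:
  fixes P :: "real mat"
  assumes P: "P \<in> carrier_mat (Suc m) (Suc m)"
    and row: "\<And>i. i < Suc m \<Longrightarrow> (\<Sum>j<Suc m. P $$ (i, j)) = 1"
  shows "char_poly P =
    [:-1, 1:] * char_poly (mat m m (\<lambda>(i, j). P $$ (Suc i, Suc j) - P $$ (0, Suc j)))"
proof -
  define N where "N = Suc m"
  define A1 where "A1 = mat 1 1 (\<lambda>_. 1 :: real)"
  define A2 where "A2 = mat 1 m (\<lambda>(i, j). P $$ (0, Suc j))"
  define A3 where "A3 = mat m m (\<lambda>(i, j). P $$ (Suc i, Suc j) - P $$ (0, Suc j))"
  define B where "B = four_block_mat A1 A2 (0\<^sub>m m 1) A3"
  \<comment> \<open>The change of basis that replaces the first unit vector by the eigenvector of all ones.\<close>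
  define Q where "Q = mat N N (\<lambda>(i, j). if i = j \<or> j = 0 then 1 else 0 :: real)"
  define Qi where "Qi = mat N N (\<lambda>(i, j). if i = j then 1 else if j = 0 then -1 else 0 :: real)"
  have carr: "A1 \<in> carrier_mat 1 1" "A2 \<in> carrier_mat 1 m" "A3 \<in> carrier_mat m m"
    "B \<in> carrier_mat N N" "Q \<in> carrier_mat N N" "Qi \<in> carrier_mat N N" "P \<in> carrier_mat N N"
    using P by (auto simp: A1_def A2_def A3_def B_def Q_def Qi_def N_def)
  have Bij: "B $$ (i, j) = (if i = 0 then if j = 0 then 1 else P $$ (0, j)
      else if j = 0 then 0 else P $$ (i, j) - P $$ (0, j))" if "i < N" "j < N" for i j
    using that by (auto simp: B_def A1_def A2_def A3_def N_def)
  have sumQ: "(\<Sum>k<N. (if i = k \<or> k = 0 then 1 else 0) * g k) = (if i = 0 then g 0 else g 0 + g i)"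
    if "i < N" for i and g :: "nat \<Rightarrow> real"
  proof -
    have "(\<Sum>k<N. (if i = k \<or> k = 0 then 1 else 0) * g k) = (\<Sum>k\<in>{0, i}. g k)"
      using that by (intro sum.mono_neutral_cong_right) (auto simp: N_def)
    then show ?thesis by auto
  qed
  have sumQi: "(\<Sum>k<N. (if i = k then 1 else if k = 0 then -1 else 0) * g k) =
      (if i = 0 then g 0 else g i - g 0)"
    if "i < N" for i and g :: "nat \<Rightarrow> real"
  proof -
    have "(\<Sum>k<N. (if i = k then 1 else if k = 0 then -1 else 0) * g k) =
        (\<Sum>k\<in>{0, i}. (if i = k then 1 else if k = 0 then -1 else 0) * g k)"
      using that by (intro sum.mono_neutral_cong_right) (auto simp: N_def)
    then show ?thesis by auto
  qed
  have mult: "(X * Y) $$ (i, j) = (\<Sum>k<N. X $$ (i, k) * Y $$ (k, j))"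
    if "X \<in> carrier_mat N N" "Y \<in> carrier_mat N N" "i < N" "j < N" for X Y :: "real mat" and i j
    using that by (auto simp: scalar_prod_def lessThan_atLeast0)
  have QQi: "Q * Qi = 1\<^sub>m N"
  proof (rule eq_matI)
    fix i j assume ij: "i < dim_row (1\<^sub>m N :: real mat)" "j < dim_col (1\<^sub>m N :: real mat)"
    then have "(Q * Qi) $$ (i, j) = (\<Sum>k<N. (if i = k \<or> k = 0 then 1 else 0) * Qi $$ (k, j))"
      using carr by (subst mult) (auto simp: Q_def)
    also have "\<dots> = 1\<^sub>m N $$ (i, j)"
      using ij by (subst sumQ) (auto simp: Qi_def N_def)
    finally show "(Q * Qi) $$ (i, j) = 1\<^sub>m N $$ (i, j)" .
  qed (use carr in auto)
  have QiQ: "Qi * Q = 1\<^sub>m N"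
  proof (rule eq_matI)
    fix i j assume ij: "i < dim_row (1\<^sub>m N :: real mat)" "j < dim_col (1\<^sub>m N :: real mat)"
    then have "(Qi * Q) $$ (i, j) =
        (\<Sum>k<N. (if i = k then 1 else if k = 0 then -1 else 0) * Q $$ (k, j))"
      using carr by (subst mult) (auto simp: Qi_def)
    also have "\<dots> = 1\<^sub>m N $$ (i, j)"
      using ij by (subst sumQi) (auto simp: Q_def N_def)
    finally show "(Qi * Q) $$ (i, j) = 1\<^sub>m N $$ (i, j)" .
  qed (use carr in auto)
  have PQ: "P * Q = Q * B"
  proof (rule eq_matI)
    fix i j assume "i < dim_row (Q * B)" "j < dim_col (Q * B)"
    then have ij: "i < N" "j < N" using carr by auto
    have "(Q * B) $$ (i, j) = (\<Sum>k<N. (if i = k \<or> k = 0 then 1 else 0) * B $$ (k, j))"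
      using carr ij by (subst mult) (auto simp: Q_def)
    also have "\<dots> = (if j = 0 then 1 else P $$ (i, j))"
      using ij by (subst sumQ) (auto simp: Bij N_def)
    also have "\<dots> = (\<Sum>k<N. P $$ (i, k) * (if k = j \<or> j = 0 then 1 else 0))"
    proof (cases "j = 0")
      case True
      then show ?thesis using row[of i] ij by (simp add: N_def)
    next
      case False
      have "(\<Sum>k<N. P $$ (i, k) * (if k = j \<or> j = 0 then 1 else 0)) =
          (\<Sum>k\<in>{j}. P $$ (i, k))"
        using False ij by (intro sum.mono_neutral_cong_right) auto
      then show ?thesis using False by simp
    qed
    also have "\<dots> = (P * Q) $$ (i, j)"
      using carr ij by (subst mult) (auto simp: Q_def)
    finally show "(P * Q) $$ (i, j) = (Q * B) $$ (i, j)" by simp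
  qed (use carr in auto)
  have "P = P * (Q * Qi)" using carr by (simp add: QQi)
  also have "\<dots> = P * Q * Qi" using carr by simp
  finally have "P = Q * B * Qi" by (simp only: PQ)
  then have "similar_mat P B"
    using carr QQi QiQ by (intro similar_matI[of _ _ Q Qi N]) auto
  then have "char_poly P = char_poly B" by (rule char_poly_similar)
  also have "\<dots> = char_poly A1 * char_poly A3"
    unfolding B_def using carr by (intro char_poly_four_block_zeros_col)
  also have "char_poly A1 = [:-1, 1:]"
    by (simp add: A1_def char_poly_defs det_def sign_def)
  finally show ?thesis by (simp add: A3_def)
qed

text \<open>The Hermitian form \<open>s\<close> of an eigenvector equals its own conjugate by
  symmetry, and it is \<open>k\<close> times the positive squared norm \<open>t\<close>.\<close>

lemma symmetric_real_eigenvalue: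
  fixes P :: "real mat"
  assumes P: "P \<in> carrier_mat N N"
    and sym: "\<And>i j. i < N \<Longrightarrow> j < N \<Longrightarrow> P $$ (i, j) = P $$ (j, i)"
    and ev: "eigenvalue (map_mat complex_of_real P) k"
  shows "k \<in> \<real>"
proof -
  define A where "A = map_mat complex_of_real P"
  obtain v where v: "v \<in> carrier_vec N" "v \<noteq> 0\<^sub>v N" "A *\<^sub>v v = k \<cdot>\<^sub>v v"
    using ev P unfolding eigenvalue_def eigenvector_def A_def by auto
  have Av: "(\<Sum>j<N. complex_of_real (P $$ (i, j)) * v $ j) = k * v $ i" if "i < N" for i
  proof -
    have "(A *\<^sub>v v) $ i = (k \<cdot>\<^sub>v v) $ i" using v by simp
    then show ?thesis
      using that P v(1) by (auto simp: A_def scalar_prod_def lessThan_atLeast0)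
  qed
  define s where "s = (\<Sum>i<N. \<Sum>j<N. cnj (v $ i) * complex_of_real (P $$ (i, j)) * v $ j)"
  define t where "t = (\<Sum>i<N. (cmod (v $ i))\<^sup>2)"
  have "s = (\<Sum>i<N. cnj (v $ i) * (\<Sum>j<N. complex_of_real (P $$ (i, j)) * v $ j))"
    by (simp add: s_def sum_distrib_left mult.assoc)
  also have "\<dots> = (\<Sum>i<N. k * complex_of_real ((cmod (v $ i))\<^sup>2))"
    by (intro sum.cong refl) (simp only: Av lessThan_iff complex_norm_square, simp)
  finally have s: "s = k * complex_of_real t"
    by (simp add: t_def sum_distrib_left)
  have "cnj s = (\<Sum>i<N. \<Sum>j<N. cnj (v $ j) * complex_of_real (P $$ (j, i)) * v $ i)"
    unfolding s_def by (auto simp: sym intro!: sum.cong)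
  also have "\<dots> = s" unfolding s_def by (rule sum.swap)
  finally have "cnj s = s" .
  moreover obtain i where i: "i < N" "v $ i \<noteq> 0"
    using v(1,2) by (metis carrier_vecD eq_vecI index_zero_vec)
  have "(cmod (v $ i))\<^sup>2 \<le> t" unfolding t_def using i by (intro member_le_sum) auto
  with i have "t > 0" by (simp add: less_le_trans[of 0 "(cmod (v $ i))\<^sup>2"])
  ultimately have "cnj k = k" using s by auto
  then show ?thesis by (simp add: Reals_cnj_iff)
qed

text \<open>\<open>proots\<close> collects only real roots. Since all complex roots are real, the
  factorization over the complex numbers is the image of a real one. The count guarantees that the
  list in \<open>eigenvalues_desc\<close> is long enough to be read at index 1.\<close>

lemma size_proots_symmetric:
  fixes P :: "real mat"
  assumes P: "P \<in> carrier_mat N N"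
    and sym: "\<And>i j. i < N \<Longrightarrow> j < N \<Longrightarrow> P $$ (i, j) = P $$ (j, i)"
  shows "size (proots (char_poly P)) = N"
proof -
  define A where "A = map_mat complex_of_real P"
  have A: "A \<in> carrier_mat N N" using P by (simp add: A_def)
  obtain as where as: "char_poly A = (\<Prod>a\<leftarrow>as. [:- a, 1:])" "length as = N"
    using char_poly_factorized[OF A] by auto
  have "a \<in> \<real>" if "a \<in> set as" for a
  proof -
    have "poly (char_poly A) a = 0"
      using that unfolding as(1) by (auto simp: poly_prod_list prod_list_zero_iff)
    then have "eigenvalue A a" by (simp add: eigenvalue_root_char_poly[OF A])
    then show ?thesis using symmetric_real_eigenvalue[OF P sym] by (simp add: A_def)
  qed
  then have re: "complex_of_real (Re a) = a" if "a \<in> set as" for a using that by simp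
  interpret map_poly_hom: map_poly_inj_comm_ring_hom complex_of_real ..
  have "map_poly complex_of_real (char_poly P) = char_poly A"
    unfolding A_def using P by (metis of_real_hom.char_poly_hom)
  also have "\<dots> = (\<Prod>a\<leftarrow>as. map_poly complex_of_real [:- Re a, 1:])"
    unfolding as(1) by (intro arg_cong[where f = prod_list] map_cong refl) (simp add: re)
  also have "\<dots> = map_poly complex_of_real (\<Prod>a\<leftarrow>as. [:- Re a, 1:])"
    by (induction as) (simp_all add: map_poly_hom.hom_mult del: mult_pCons_left)
  finally have "char_poly P = (\<Prod>a\<leftarrow>as. [:- Re a, 1:])"
    by simp
  moreover have "size (proots (\<Prod>a\<leftarrow>bs. [:- Re a, 1:])) = length bs" for bs
  proof (induction bs)
    case (Cons b bs)
    have "(\<Prod>a\<leftarrow>bs. [:- Re a, 1:]) \<noteq> 0"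
      by (auto simp: prod_list_zero_iff)
    then show ?case using Cons by (auto simp: proots_mult simp del: mult_pCons_left)
  qed simp
  ultimately show ?thesis using as(2) by simp
qed

text \<open>For every root \<open>\<mu>\<close> that remains after one 1 is split off, the Poincare
  inequality is tested on a centred eigenfunction \<open>f\<close>. With S the sum of the squares of
  \<open>f\<close>, it reads 2NS \<le> KN * 2(1 - \<mu>)S.\<close>

lemma stochastic_second_eigenvalue:
  fixes P :: "real mat"
  assumes P: "P \<in> carrier_mat N N" and N: "2 \<le> N"
    and sym: "\<And>i j. i < N \<Longrightarrow> j < N \<Longrightarrow> P $$ (i, j) = P $$ (j, i)"
    and row: "\<And>i. i < N \<Longrightarrow> (\<Sum>j<N. P $$ (i, j)) = 1"
    and poincare: "\<And>f :: nat \<Rightarrow> real. (\<Sum>i<N. \<Sum>j<N. (f i - f j)\<^sup>2) \<le>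
      K * N * (\<Sum>i<N. \<Sum>j<N. P $$ (i, j) * (f i - f j)\<^sup>2)"
    and K: "0 < K"
  shows "1 \<le> K * (1 - eigenvalues_desc P ! 1)"
proof -
  obtain m where m: "N = Suc m" "1 \<le> m" using N by (cases N) auto
  define P' where "P' = mat m m (\<lambda>(i, j). P $$ (Suc i, Suc j) - P $$ (0, Suc j))"
  have P': "P' \<in> carrier_mat m m" by (simp add: P'_def)
  have cp: "char_poly P = [:-1, 1:] * char_poly P'"
    unfolding P'_def using P row m(1) by (intro char_poly_stochastic) auto
  define M where "M = proots (char_poly P')"
  have cp0: "char_poly P' \<noteq> 0" using degree_monic_char_poly[OF P'] by auto
  then have proots: "proots (char_poly P) = add_mset 1 M"
    unfolding cp M_def by (subst proots_mult) auto
  have bound: "1 \<le> K * (1 - \<mu>)" if \<mu>: "\<mu> \<in># M" for \<mu>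
  proof -
    have "eigenvalue P' \<mu>"
      using \<mu> cp0 by (simp add: M_def eigenvalue_root_char_poly[OF P'])
    then obtain v where v: "v \<in> carrier_vec m" "v \<noteq> 0\<^sub>v m" "P' *\<^sub>v v = \<mu> \<cdot>\<^sub>v v"
      using P' unfolding eigenvalue_def eigenvector_def by auto
    \<comment> \<open>An eigenvector of the reduced block, extended by 0 at index 0, is an
      eigenfunction of \<open>P\<close> up to an additive constant, namely
      \<open>Pg 0\<close>.\<close>
    define g where "g i = (case i of 0 \<Rightarrow> 0 | Suc i \<Rightarrow> v $ i)" for i
    define Pg where "Pg i = (\<Sum>j<N. P $$ (i, j) * g j)" for i
    have Pg: "Pg i = \<mu> * g i + Pg 0" if "i < N" for i
    proof (cases i)
      case (Suc i')
      then have "(P' *\<^sub>v v) $ i' = \<mu> * v $ i'" using v that m by simp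
      moreover have "(P' *\<^sub>v v) $ i' = (\<Sum>j<m. (P $$ (i, Suc j) - P $$ (0, Suc j)) * v $ j)"
        using that Suc v(1) by (simp add: P'_def m scalar_prod_def lessThan_atLeast0)
      also have "\<dots> = Pg i - Pg 0"
        unfolding Pg_def m(1)
        by (simp add: sum.lessThan_Suc_shift g_def algebra_simps sum_subtractf del: sum.lessThan_Suc)
      ultimately show ?thesis using Suc by (simp add: g_def)
    qed (simp add: g_def)
    define c where "c = (\<Sum>i<N. g i) / N"
    define f where "f i = g i - c" for i
    have f_sum: "(\<Sum>i<N. f i) = 0"
      using m(1) by (simp add: f_def sum_subtractf c_def)
    define Pf where "Pf i = (\<Sum>j<N. P $$ (i, j) * f j)" for i
    obtain b where b: "Pf i = \<mu> * f i + b" if "i < N" for i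
    proof
      fix i assume "i < N"
      then have "Pf i = Pg i - c * (\<Sum>j<N. P $$ (i, j))"
        by (simp add: Pf_def Pg_def f_def algebra_simps sum_subtractf sum_distrib_left)
      then show "Pf i = \<mu> * f i + (\<mu> * c - c + Pg 0)"
        unfolding Pg[OF \<open>i < N\<close>] row[OF \<open>i < N\<close>] by (simp add: f_def algebra_simps)
    qed
    \<comment> \<open>Centring makes the constant vanish: by symmetry the columns also sum to 1, so
      \<open>Pf\<close> sums to 0 like \<open>f\<close>, and N * \<open>b\<close> = 0.\<close>
    have "(\<Sum>i<N. Pf i) = (\<Sum>j<N. (\<Sum>i<N. P $$ (j, i)) * f j)"
      unfolding Pf_def by (subst sum.swap) (auto simp: sum_distrib_right sym intro!: sum.cong)
    also have "\<dots> = 0" using f_sum by (simp add: row)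
    also have "(\<Sum>i<N. Pf i) = N * b"
      using f_sum by (simp add: b sum.distrib flip: sum_distrib_left)
    finally have "b = 0" using m by simp
    define S where "S = (\<Sum>i<N. (f i)\<^sup>2)"
    have "(\<Sum>i<N. \<Sum>j<N. (f i - f j)\<^sup>2) =
        (\<Sum>i<N. (N * (f i)\<^sup>2 + S) - 2 * f i * (\<Sum>j<N. f j))"
      by (simp add: power2_diff sum.distrib sum_subtractf S_def sum_distrib_left mult.assoc)
    also have "\<dots> = 2 * N * S"
      by (simp add: f_sum sum.distrib S_def flip: sum_distrib_left)
    finally have lhs: "(\<Sum>i<N. \<Sum>j<N. (f i - f j)\<^sup>2) = 2 * N * S" .
    have "(\<Sum>i<N. \<Sum>j<N. P $$ (i, j) * (f i - f j)\<^sup>2) =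
        (\<Sum>i<N. (\<Sum>j<N. P $$ (i, j)) * (f i)\<^sup>2) + (\<Sum>i<N. \<Sum>j<N. P $$ (i, j) * (f j)\<^sup>2)
        - 2 * (\<Sum>i<N. f i * Pf i)"
      by (simp add: power2_diff sum.distrib sum_subtractf sum_distrib_left sum_distrib_right
          Pf_def algebra_simps)
    also have "(\<Sum>i<N. \<Sum>j<N. P $$ (i, j) * (f j)\<^sup>2) = (\<Sum>j<N. (\<Sum>i<N. P $$ (j, i)) * (f j)\<^sup>2)"
      by (subst sum.swap) (auto simp: sum_distrib_right sym intro!: sum.cong)
    also have "(\<Sum>i<N. f i * Pf i) = \<mu> * S"
      using \<open>b = 0\<close> by (auto simp: b S_def sum_distrib_left power2_eq_square intro!: sum.cong)
    finally have rhs: "(\<Sum>i<N. \<Sum>j<N. P $$ (i, j) * (f i - f j)\<^sup>2) = 2 * (1 - \<mu>) * S"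
      by (simp add: row S_def algebra_simps)
    \<comment> \<open>If S were 0, then \<open>g\<close> would be constant, hence 0 because of its
      value at index 0, and so would \<open>v\<close>.\<close>
    have "S \<noteq> 0"
    proof
      assume "S = 0"
      then have f0: "f i = 0" if "i < N" for i
        using that unfolding S_def by (subst (asm) sum_nonneg_eq_0_iff) auto
      then have "c = 0" using f0[of 0] m by (simp add: f_def g_def)
      then have "v $ i = 0" if "i < m" for i
        using f0[of "Suc i"] that m by (simp add: f_def g_def)
      then have "v = 0\<^sub>v m" using v(1) by (intro eq_vecI) auto
      then show False using v(2) by simp
    qed
    moreover have "S \<ge> 0" by (simp add: S_def sum_nonneg)
    ultimately have S: "S > 0" by simp
    have "2 * N * S \<le> K * N * (2 * (1 - \<mu>) * S)"
      using poincare[of f] unfolding lhs rhs by simp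
    then have "(2 * N * S) * 1 \<le> (2 * N * S) * (K * (1 - \<mu>))"
      by (simp add: mult_ac)
    then show ?thesis using S m by (subst (asm) mult_le_cancel_left_pos) auto
  qed
  have "size M = m"
    using size_proots_symmetric[OF P sym] proots m by simp
  then have M: "sorted_list_of_multiset M \<noteq> []"
    using m by (metis length_0_conv mset_sorted_list_of_multiset not_one_le_zero size_mset)
  \<comment> \<open>This puts the split-off eigenvalue 1 at the head of the decreasing list, so
    index 1 falls on an element of \<open>M\<close>, to which \<open>bound\<close> applies.\<close>
  have "\<mu> \<le> 1" if "\<mu> \<in># M" for \<mu>
    using bound[OF that] K
    by (metis diff_ge_0_iff_ge less_eq_real_def mult_less_0_iff not_le order.trans zero_le_one)
  then have "insort 1 (sorted_list_of_multiset M) = sorted_list_of_multiset M @ [1]"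
    by (intro sorted_insort_is_snoc) auto
  then have "eigenvalues_desc P = 1 # rev (sorted_list_of_multiset M)"
    by (simp add: eigenvalues_desc_def proots)
  moreover have "rev (sorted_list_of_multiset M) ! 0 \<in> set (rev (sorted_list_of_multiset M))"
    using M by (intro nth_mem) simp
  ultimately show ?thesis using bound by simp
qed

section \<open>Connectivity under swaps\<close>

text \<open>Adjacency in the chain without reference to \<open>n\<close> or to probabilities, so
  that the same relation serves a block and the whole graph. The four membership conditions already
  force the vertices of each pair to be distinct.\<close>

definition swap :: "bigraph \<Rightarrow> bigraph \<Rightarrow> bool" where
  "swap G H \<longleftrightarrow> (\<exists>a b c d. (a, c) \<in> G \<and> (b, d) \<in> G \<and> (b, c) \<notin> G \<and> (a, d) \<notin> G \<and>
     H = G - {(a, c), (b, d)} \<union> {(b, c), (a, d)})"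

text \<open>Arbitrary and possibly unequal vertex sets are allowed because blocks sit on arbitrary
  subsets, and the connectivity proof deletes vertices of one class only.\<close>

definition marg_realizations ::
  "nat set \<Rightarrow> nat set \<Rightarrow> (nat \<Rightarrow> nat) \<Rightarrow> (nat \<Rightarrow> nat) \<Rightarrow> bigraph set" where
  "marg_realizations X Y d e = {G. G \<subseteq> X \<times> Y \<and>
     (\<forall>x\<in>X. card {y. (x, y) \<in> G} = d x) \<and> (\<forall>y\<in>Y. card {x. (x, y) \<in> G} = e y)}"

lemma swapE:
  assumes "swap G H"
  obtains a b c d where "(a, c) \<in> G" "(b, d) \<in> G" "(b, c) \<notin> G" "(a, d) \<notin> G"
    "H = G - {(a, c), (b, d)} \<union> {(b, c), (a, d)}" "a \<noteq> b" "c \<noteq> d"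
  using assms unfolding swap_def
proof (elim exE conjE)
  fix a b c d
  assume *: "(a, c) \<in> G" "(b, d) \<in> G" "(b, c) \<notin> G" "(a, d) \<notin> G"
    "H = G - {(a, c), (b, d)} \<union> {(b, c), (a, d)}"
  then have "a \<noteq> b" "c \<noteq> d" by metis+
  with * show thesis by (rule that)
qed

lemma swapI:
  assumes "(a, c) \<in> G" "(b, d) \<in> G" "(b, c) \<notin> G" "(a, d) \<notin> G"
    "H = G - {(a, c), (b, d)} \<union> {(b, c), (a, d)}"
  shows "swap G H"
  unfolding swap_def
  by (rule exI[where x = a], rule exI[where x = b], rule exI[where x = c], rule exI[where x = d])
    (use assms in simp)

lemma swap_sym:
  assumes "swap G H"
  shows "swap H G"
  using assms
proof (rule swapE)
  fix a b c d
  assume *: "(a, c) \<in> G" "(b, d) \<in> G" "(b, c) \<notin> G" "(a, d) \<notin> G"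
    "H = G - {(a, c), (b, d)} \<union> {(b, c), (a, d)}" "a \<noteq> b" "c \<noteq> d"
  have "G = H - {(b, c), (a, d)} \<union> {(a, c), (b, d)}"
    unfolding *(5) using *(1-4) by blast
  then show ?thesis by (rule swapI[rotated 4]) (use * in auto)
qed

lemma swap_irrefl: "\<not> swap G G"
  by (auto elim!: swapE)

lemma swap_degrees:
  assumes "swap G H" "finite G"
  shows "card {y. (x, y) \<in> H} = card {y. (x, y) \<in> G}"
    and "card {x. (x, y) \<in> H} = card {x. (x, y) \<in> G}"
proof -
  obtain a b c d where *: "(a, c) \<in> G" "(b, d) \<in> G" "(b, c) \<notin> G" "(a, d) \<notin> G"
    "H = G - {(a, c), (b, d)} \<union> {(b, c), (a, d)}" "a \<noteq> b" "c \<noteq> d"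
    using assms(1) by (rule swapE)
  have fin: "finite {y. (x, y) \<in> G}" "finite {x. (x, y) \<in> G}" for x y
    using assms(2) finite_subset[of "{y. (x, y) \<in> G}" "snd ` G"]
      finite_subset[of "{x. (x, y) \<in> G}" "fst ` G"] by force+
  have exchange: "card (N - {u} \<union> {v}) = card N" if "finite N" "u \<in> N" "v \<notin> N" for N :: "nat set" and u v
    using that card_Suc_Diff1[of N u] by simp
  have "{y. (x, y) \<in> H} = (if x = a then {y. (x, y) \<in> G} - {c} \<union> {d}
      else if x = b then {y. (x, y) \<in> G} - {d} \<union> {c} else {y. (x, y) \<in> G})"
    using * by auto
  then show "card {y. (x, y) \<in> H} = card {y. (x, y) \<in> G}"
    using * fin by (auto simp: exchange simp del: Un_insert_right)
  have "{x. (x, y) \<in> H} = (if y = c then {x. (x, y) \<in> G} - {a} \<union> {b}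
      else if y = d then {x. (x, y) \<in> G} - {b} \<union> {a} else {x. (x, y) \<in> G})"
    using * by auto
  then show "card {x. (x, y) \<in> H} = card {x. (x, y) \<in> G}"
    using * fin by (auto simp: exchange simp del: Un_insert_right)
qed

lemma marg_realizations_finite:
  assumes "finite X" "finite Y"
  shows "finite (marg_realizations X Y d e)" "G \<in> marg_realizations X Y d e \<Longrightarrow> finite G"
proof -
  have "marg_realizations X Y d e \<subseteq> Pow (X \<times> Y)"
    by (auto simp: marg_realizations_def)
  then show "finite (marg_realizations X Y d e)"
    by (rule finite_subset) (use assms in auto)
  show "finite G" if "G \<in> marg_realizations X Y d e"
    using that assms finite_subset[of G "X \<times> Y"] by (auto simp: marg_realizations_def)
qed

lemma swap_marg_realizations:
  assumes "swap G H" "G \<in> marg_realizations X Y d e" "finite X" "finite Y"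
  shows "H \<in> marg_realizations X Y d e"
proof -
  have "finite G" using marg_realizations_finite(2)[OF assms(3,4,2)] .
  note deg = swap_degrees[OF assms(1) this]
  have "H \<subseteq> X \<times> Y"
    using assms(1,2) by (auto simp: marg_realizations_def elim!: swapE)
  then show ?thesis using assms(2) by (simp add: marg_realizations_def deg)
qed

lemma swaps_marg_realizations:
  assumes "swap\<^sup>*\<^sup>* G H" "G \<in> marg_realizations X Y d e" "finite X" "finite Y"
  shows "H \<in> marg_realizations X Y d e"
  using assms(1)
proof (induction rule: rtranclp_induct)
  case (step G' H')
  then show ?case using swap_marg_realizations assms(3,4) by metis
qed (rule assms(2))

lemma swaps_sym: "swap\<^sup>*\<^sup>* G H \<Longrightarrow> swap\<^sup>*\<^sup>* H G"
proof (induction rule: rtranclp_induct)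
  case (step G' H')
  then show ?case using swap_sym converse_rtranclp_into_rtranclp[of swap H' G' G] by simp
qed simp

text \<open>If \<open>c\<close> is a neighbour of \<open>a\<close> only in \<open>G\<close> and \<open>d\<close> only in \<open>H\<close>, then a swap exchanging \<open>c\<close> and
  \<open>d\<close> at \<open>a\<close> exists in \<open>G\<close> when \<open>d\<close> has at least the degree of \<open>c\<close>, and in \<open>H\<close> otherwise.\<close>

lemma swap_exchange:
  assumes "finite X" "G \<subseteq> X \<times> Y" "(a, c) \<in> G" "(a, d) \<notin> G"
    and "card {x. (x, c) \<in> G} \<le> card {x. (x, d) \<in> G}"
  obtains G' where "swap G G'" "{y. (a, y) \<in> G'} = {y. (a, y) \<in> G} - {c} \<union> {d}"
proof -
  have fin: "finite {x. (x, y) \<in> G}" for y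
    using assms(1,2) by (auto intro: finite_subset[of _ X])
  \<comment> \<open>The neighbourhood of \<open>d\<close> is at least as large as that of
    \<open>c\<close>, and \<open>a\<close> belongs only to the latter. So \<open>d\<close> has a
    neighbour \<open>b\<close> that \<open>c\<close> lacks, and \<open>b\<close> completes the
    swap.\<close>
  have "\<not> {x. (x, d) \<in> G} \<subseteq> {x. (x, c) \<in> G} - {a}"
  proof
    assume "{x. (x, d) \<in> G} \<subseteq> {x. (x, c) \<in> G} - {a}"
    then have "card {x. (x, d) \<in> G} \<le> card ({x. (x, c) \<in> G} - {a})"
      using fin by (intro card_mono) auto
    also have "\<dots> < card {x. (x, c) \<in> G}"
      using fin assms(3) by (intro psubset_card_mono) auto
    finally show False using assms(5) by simp
  qed
  then obtain b where b: "(b, d) \<in> G" "(b, c) \<notin> G" "b \<noteq> a"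
    using assms(4) by blast
  define G' where "G' = G - {(a, c), (b, d)} \<union> {(b, c), (a, d)}"
  have "swap G G'" unfolding G'_def using assms(3,4) b by (intro swapI[of a c _ b d]) auto
  moreover have "{y. (a, y) \<in> G'} = {y. (a, y) \<in> G} - {c} \<union> {d}"
    unfolding G'_def using b by auto
  ultimately show ?thesis by (rule that)
qed

text \<open>Both graphs have the same degrees \<open>e\<close> on \<open>Y\<close>, so comparing
  \<open>e c\<close> with \<open>e c'\<close> decides which of the two graphs admits the exchange at
  \<open>a\<close>. Either choice shrinks the difference of the two neighbourhoods. Moving both
  graphs is harmless because swaps are reversible.\<close>

lemma swaps_agree_at:
  assumes "finite X" "finite Y" "a \<in> X"
    and "G \<in> marg_realizations X Y d e" "H \<in> marg_realizations X Y d e"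
  shows "\<exists>G' H'. swap\<^sup>*\<^sup>* G G' \<and> swap\<^sup>*\<^sup>* H H' \<and> {y. (a, y) \<in> G'} = {y. (a, y) \<in> H'}"
  using assms(4,5)
proof (induction "card ({y. (a, y) \<in> G} - {y. (a, y) \<in> H})" arbitrary: G H rule: less_induct)
  case less
  let ?N = "\<lambda>G. {y. (a, y) \<in> G}"
  have GH: "G \<subseteq> X \<times> Y" "H \<subseteq> X \<times> Y" "card (?N G) = card (?N H)"
    "\<And>y. y \<in> Y \<Longrightarrow> card {x. (x, y) \<in> G} = e y" "\<And>y. y \<in> Y \<Longrightarrow> card {x. (x, y) \<in> H} = e y"
    using less.prems assms(3) by (auto simp: marg_realizations_def)
  have fin: "finite (?N G)" "finite (?N H)"
    using GH assms(2) by (auto intro: finite_subset[of _ Y])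
  show ?case
  proof (cases "?N G = ?N H")
    case False
    have "\<not> ?N G \<subseteq> ?N H" "\<not> ?N H \<subseteq> ?N G"
      using False card_subset_eq[OF fin(2)] card_subset_eq[OF fin(1)] GH(3) by metis+
    then obtain c c' where c: "(a, c) \<in> G" "(a, c) \<notin> H" "(a, c') \<in> H" "(a, c') \<notin> G"
      by blast
    then have Y: "c \<in> Y" "c' \<in> Y" using GH by auto
    have smaller: "card (A - {c} \<union> {c'} - B) < card (A - B)" "card (A - (B - {c'} \<union> {c})) < card (A - B)"
      if "finite A" "c \<in> A" "c \<notin> B" "c' \<in> B" "c' \<notin> A" for A B
      using that by (auto intro!: psubset_card_mono simp del: Un_insert_right)
    show ?thesis
    proof (cases "e c \<le> e c'")
      case True
      then obtain G' where G': "swap G G'" "?N G' = ?N G - {c} \<union> {c'}"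
        using swap_exchange[OF assms(1) GH(1) c(1,4)] GH(4) Y by auto
      have "G' \<in> marg_realizations X Y d e"
        using swap_marg_realizations G'(1) less.prems(1) assms(1,2) by blast
      moreover have "card (?N G' - ?N H) < card (?N G - ?N H)"
        unfolding G'(2) using c fin by (intro smaller) auto
      ultimately obtain G'' H' where "swap\<^sup>*\<^sup>* G' G''" "swap\<^sup>*\<^sup>* H H'" "?N G'' = ?N H'"
        using less.hyps less.prems(2) by blast
      then show ?thesis using G'(1) by (meson converse_rtranclp_into_rtranclp)
    next
      case False
      then obtain H' where H': "swap H H'" "?N H' = ?N H - {c'} \<union> {c}"
        using swap_exchange[OF assms(1) GH(2) c(3,2)] GH(5) Y by auto
      have "H' \<in> marg_realizations X Y d e"
        using swap_marg_realizations H'(1) less.prems(2) assms(1,2) by blast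
      moreover have "card (?N G - ?N H') < card (?N G - ?N H)"
        unfolding H'(2) using c fin by (intro smaller) auto
      ultimately obtain G'' H'' where "swap\<^sup>*\<^sup>* G G''" "swap\<^sup>*\<^sup>* H' H''" "?N G'' = ?N H''"
        using less.hyps less.prems(1) by blast
      then show ?thesis using H'(1) by (meson converse_rtranclp_into_rtranclp)
    qed
  qed blast
qed

text \<open>All four pairs of a swap lie in the rectangle \<open>X \<times> Y\<close>, so edges
  outside it are inert. This lifts swaps from a vertex-deleted graph and from a block of a
  composition.\<close>

lemma swap_add:
  assumes "swap G H" "G \<subseteq> X \<times> Y" "Z \<inter> X \<times> Y = {}"
  shows "swap (G \<union> Z) (H \<union> Z)"
  using assms(1)
proof (rule swapE)
  fix a b c d
  assume *: "(a, c) \<in> G" "(b, d) \<in> G" "(b, c) \<notin> G" "(a, d) \<notin> G"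
    "H = G - {(a, c), (b, d)} \<union> {(b, c), (a, d)}" "a \<noteq> b" "c \<noteq> d"
  then have "(a, c) \<notin> Z" "(b, d) \<notin> Z" "(b, c) \<notin> Z" "(a, d) \<notin> Z"
    using assms(2,3) by auto
  then show ?thesis
    using * by (intro swapI[of a c _ b d]) auto
qed

text \<open>Once the two graphs agree at \<open>a\<close>, deleting \<open>a\<close> leaves two
  realizations of the same reduced degrees. The induction hypothesis connects them, and
  \<open>swap_add\<close> restores the common edges at \<open>a\<close>.\<close>

theorem swap_connected:
  assumes "finite X" "finite Y" "G \<in> marg_realizations X Y d e" "H \<in> marg_realizations X Y d e"
  shows "swap\<^sup>*\<^sup>* G H"
  using assms(1,3,4)
proof (induction X arbitrary: G H e rule: finite_induct)
  case empty
  then show ?case by (auto simp: marg_realizations_def)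
next
  case (insert a X)
  obtain G' H' where 1: "swap\<^sup>*\<^sup>* G G'" "swap\<^sup>*\<^sup>* H H'" "{y. (a, y) \<in> G'} = {y. (a, y) \<in> H'}"
    using swaps_agree_at[OF _ assms(2) insertI1 insert.prems] insert.hyps by auto
  then have GH': "G' \<in> marg_realizations (insert a X) Y d e" "H' \<in> marg_realizations (insert a X) Y d e"
    using swaps_marg_realizations insert.prems insert.hyps assms(2) by blast+
  define S where "S = {y. (a, y) \<in> G'}"
  have S: "S = {y. (a, y) \<in> H'}" "S \<subseteq> Y" using 1(3) GH' by (auto simp: S_def marg_realizations_def)
  \<comment> \<open>The subtraction does not truncate: a vertex in \<open>S\<close> is adjacent to
    \<open>a\<close>, so its degree is at least 1.\<close>
  define e' where "e' y = (if y \<in> S then e y - 1 else e y)" for y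
  have restrict: "K - {a} \<times> S \<in> marg_realizations X Y d e'"
    if K: "K \<in> marg_realizations (insert a X) Y d e" and KS: "{y. (a, y) \<in> K} = S" for K
  proof -
    have "{y. (x, y) \<in> K - {a} \<times> S} = {y. (x, y) \<in> K}" if "x \<in> X" for x
      using that insert.hyps by auto
    moreover have "card {x. (x, y) \<in> K - {a} \<times> S} = e' y" if "y \<in> Y" for y
    proof (cases "y \<in> S")
      case True
      then have "{x. (x, y) \<in> K - {a} \<times> S} = {x. (x, y) \<in> K} - {a}" "(a, y) \<in> K"
        using KS by auto
      moreover have "card {x. (x, y) \<in> K} = e y"
        using K that by (auto simp: marg_realizations_def)
      ultimately show ?thesis using True by (simp add: e'_def)
    next
      case False
      then have "{x. (x, y) \<in> K - {a} \<times> S} = {x. (x, y) \<in> K}" by auto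
      then show ?thesis using False K that by (auto simp: e'_def marg_realizations_def)
    qed
    moreover have "K - {a} \<times> S \<subseteq> X \<times> Y"
      using K KS by (auto simp: marg_realizations_def)
    ultimately show ?thesis using K by (auto simp: marg_realizations_def)
  qed
  have R: "G' - {a} \<times> S \<in> marg_realizations X Y d e'" "H' - {a} \<times> S \<in> marg_realizations X Y d e'"
    using restrict GH' S S_def by auto
  from insert.IH[OF this] have "swap\<^sup>*\<^sup>* (G' - {a} \<times> S) (H' - {a} \<times> S)" .
  then have "swap\<^sup>*\<^sup>* (G' - {a} \<times> S \<union> {a} \<times> S) (H' - {a} \<times> S \<union> {a} \<times> S)"
  proof (induction rule: rtranclp_induct)
    case (step K L)
    have "K \<in> marg_realizations X Y d e'"
      using swaps_marg_realizations step.hyps(1) R(1) insert.hyps assms(2) by blast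
    then have "K \<subseteq> X \<times> Y" by (simp add: marg_realizations_def)
    then have "swap (K \<union> {a} \<times> S) (L \<union> {a} \<times> S)"
      using step.hyps(2) insert.hyps by (intro swap_add[where X = X and Y = Y]) auto
    then show ?case using step.IH by (rule rtranclp.rtrancl_into_rtrancl[rotated])
  qed simp
  moreover have "G' - {a} \<times> S \<union> {a} \<times> S = G'" "H' - {a} \<times> S \<union> {a} \<times> S = H'"
    using S S_def by auto
  ultimately have "swap\<^sup>*\<^sup>* G' H'" by simp
  then show ?case using 1 swaps_sym by (meson rtranclp_trans)
qed

section \<open>Poincare inequalities\<close>

text \<open>The left side is 2 * \<open>card S\<close>^2 times the variance under the uniform
  distribution. The right side is the Dirichlet form of the swap graph with unit weights. With the
  factor \<open>card S\<close> the constant does not change when independent state spaces are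
  multiplied.\<close>

definition poincare :: "real \<Rightarrow> bigraph set \<Rightarrow> bool" where
  "poincare C S \<longleftrightarrow> (\<forall>f :: bigraph \<Rightarrow> real.
     (\<Sum>x\<in>S. \<Sum>y\<in>S. (f x - f y)\<^sup>2) \<le> C * card S * (\<Sum>x\<in>S. \<Sum>y\<in>S. of_bool (swap x y) * (f x - f y)\<^sup>2))"

lemma poincare_mono:
  assumes "poincare C S" "C \<le> C'"
  shows "poincare C' S"
  unfolding poincare_def
proof
  fix f :: "bigraph \<Rightarrow> real"
  have "(\<Sum>x\<in>S. \<Sum>y\<in>S. (f x - f y)\<^sup>2)
      \<le> C * (card S * (\<Sum>x\<in>S. \<Sum>y\<in>S. of_bool (swap x y) * (f x - f y)\<^sup>2))"
    using assms(1) by (auto simp: poincare_def mult.assoc)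
  also have "\<dots> \<le> C' * (card S * (\<Sum>x\<in>S. \<Sum>y\<in>S. of_bool (swap x y) * (f x - f y)\<^sup>2))"
    using assms(2) by (intro mult_right_mono mult_nonneg_nonneg sum_nonneg) auto
  finally show "(\<Sum>x\<in>S. \<Sum>y\<in>S. (f x - f y)\<^sup>2)
      \<le> C' * card S * (\<Sum>x\<in>S. \<Sum>y\<in>S. of_bool (swap x y) * (f x - f y)\<^sup>2)"
    by (simp add: mult.assoc)
qed

text \<open>Each pair of states is joined by a path, along which the difference of \<open>f\<close>
  is controlled by the Dirichlet form \<open>E\<close>. The constant may be exponential in the path
  length, which does no harm for blocks of bounded size.\<close>

lemma poincare_connected:
  assumes fin: "finite S" and conn: "\<And>x y. x \<in> S \<Longrightarrow> y \<in> S \<Longrightarrow> swap\<^sup>*\<^sup>* x y"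
    and closed: "\<And>x y. x \<in> S \<Longrightarrow> swap x y \<Longrightarrow> y \<in> S"
  shows "\<exists>C. poincare C S"
proof -
  define E where "E f = (\<Sum>x\<in>S. \<Sum>y\<in>S. of_bool (swap x y) * (f x - f y)\<^sup>2)" for f :: "bigraph \<Rightarrow> real"
  have E: "(f x - f y)\<^sup>2 \<le> E f" if "x \<in> S" "y \<in> S" "swap x y" for f x y
  proof -
    have "(f x - f y)\<^sup>2 \<le> (\<Sum>y\<in>S. of_bool (swap x y) * (f x - f y)\<^sup>2)"
      using fin that member_le_sum[of y S "\<lambda>y. of_bool (swap x y) * (f x - f y)\<^sup>2"] by simp
    also have "\<dots> \<le> E f"
      unfolding E_def using fin that
      by (intro member_le_sum[of x S "\<lambda>x. \<Sum>y\<in>S. of_bool (swap x y) * (f x - f y)\<^sup>2"])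
        (auto intro!: sum_nonneg)
    finally show ?thesis .
  qed
  have "\<exists>c\<ge>0. \<forall>f. (f x - f y)\<^sup>2 \<le> c * E f" if "x \<in> S" "y \<in> S" for x y
    using conn[OF that]
  proof (induction rule: rtranclp_induct)
    case base
    show ?case by (auto intro!: exI[of _ 0])
  next
    case (step u v)
    from step.IH obtain c where c: "c \<ge> 0" "\<And>f. (f x - f u)\<^sup>2 \<le> c * E f" by blast
    have "u \<in> S" using step.hyps(1) by (induction rule: rtranclp_induct) (use that closed in auto)
    then have uv: "u \<in> S" "v \<in> S" using closed step.hyps by auto
    have "(f x - f v)\<^sup>2 \<le> (2 * c + 2) * E f" for f
    proof -
      \<comment> \<open>This is (s + t)^2 \<le> 2 s^2 + 2 t^2 for the two legs of the path, the
        source of the recursion \<open>2 * c + 2\<close>.\<close>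
      have "0 \<le> ((f x - f u) - (f u - f v))\<^sup>2" by simp
      then have "(f x - f v)\<^sup>2 \<le> 2 * (f x - f u)\<^sup>2 + 2 * (f u - f v)\<^sup>2"
        by (simp add: power2_eq_square algebra_simps)
      also have "\<dots> \<le> 2 * (c * E f) + 2 * E f"
        using c(2)[of f] E[OF uv step.hyps(2), of f] by simp
      finally show ?thesis by (simp add: algebra_simps)
    qed
    then show ?case using c(1) by (intro exI[of _ "2 * c + 2"]) auto
  qed
  then obtain c where c: "\<And>x y. x \<in> S \<Longrightarrow> y \<in> S \<Longrightarrow> c x y \<ge> 0"
    "\<And>x y f. x \<in> S \<Longrightarrow> y \<in> S \<Longrightarrow> (f x - f y)\<^sup>2 \<le> c x y * E f"
    by metis
  define C where "C = (\<Sum>x\<in>S. \<Sum>y\<in>S. c x y)"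
  have "(\<Sum>x\<in>S. \<Sum>y\<in>S. (f x - f y)\<^sup>2) \<le> C * E f" for f :: "bigraph \<Rightarrow> real"
    unfolding C_def sum_distrib_right using c(2) by (intro sum_mono) auto
  then have "poincare (C / card S) S"
    unfolding poincare_def E_def by (cases "S = {}") (auto simp: fin)
  then show ?thesis ..
qed

text \<open>The Efron--Stein inequality for two coordinates; the constant does not deteriorate.\<close>

lemma variance_product:
  fixes f :: "'a \<Rightarrow> 'b \<Rightarrow> real"
  shows "(\<Sum>x\<in>S. \<Sum>y\<in>T. \<Sum>x'\<in>S. \<Sum>y'\<in>T. (f x y - f x' y')\<^sup>2) \<le>
    card T * (\<Sum>y\<in>T. \<Sum>x\<in>S. \<Sum>x'\<in>S. (f x y - f x' y)\<^sup>2) +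
    card S * (\<Sum>x\<in>S. \<Sum>y\<in>T. \<Sum>y'\<in>T. (f x y - f x y')\<^sup>2)"
proof -
  let ?\<Sigma> = "\<lambda>h. \<Sum>x\<in>S. \<Sum>x'\<in>S. \<Sum>y\<in>T. \<Sum>y'\<in>T. h x x' y y' :: real"
  have L1: "(\<Sum>x\<in>S. \<Sum>y\<in>T. \<Sum>x'\<in>S. \<Sum>y'\<in>T. (f x y - f x' y')\<^sup>2) = ?\<Sigma> (\<lambda>x x' y y'. (f x y - f x' y')\<^sup>2)"
    by (intro sum.cong refl sum.swap)
  have L2: "?\<Sigma> (\<lambda>x x' y y'. (f x y - f x' y')\<^sup>2) = ?\<Sigma> (\<lambda>x x' y y'. (f x y' - f x' y)\<^sup>2)"
    by (intro sum.cong refl sum.swap)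
  have A1: "card T * (\<Sum>y\<in>T. \<Sum>x\<in>S. \<Sum>x'\<in>S. (f x y - f x' y)\<^sup>2) = ?\<Sigma> (\<lambda>x x' y y'. (f x y - f x' y)\<^sup>2)"
  proof -
    have "(\<Sum>y\<in>T. \<Sum>x\<in>S. \<Sum>x'\<in>S. (f x y - f x' y)\<^sup>2) = (\<Sum>x\<in>S. \<Sum>x'\<in>S. \<Sum>y\<in>T. (f x y - f x' y)\<^sup>2)"
      by (subst sum.swap) (intro sum.cong refl sum.swap)
    then show ?thesis by (simp add: sum_distrib_left)
  qed
  have A2: "?\<Sigma> (\<lambda>x x' y y'. (f x y - f x' y)\<^sup>2) = ?\<Sigma> (\<lambda>x x' y y'. (f x y' - f x' y')\<^sup>2)"
    by (intro sum.cong refl sum.swap)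
  have B1: "card S * (\<Sum>x\<in>S. \<Sum>y\<in>T. \<Sum>y'\<in>T. (f x y - f x y')\<^sup>2) = ?\<Sigma> (\<lambda>x x' y y'. (f x y - f x y')\<^sup>2)"
    by (simp add: sum_distrib_left)
  have B2: "?\<Sigma> (\<lambda>x x' y y'. (f x y - f x y')\<^sup>2) = ?\<Sigma> (\<lambda>x x' y y'. (f x' y - f x' y')\<^sup>2)"
    by (rule sum.swap)
  have "?\<Sigma> (\<lambda>x x' y y'. (f x y - f x' y')\<^sup>2 + (f x y' - f x' y)\<^sup>2) \<le>
      ?\<Sigma> (\<lambda>x x' y y'. (f x y - f x' y)\<^sup>2 + (f x y' - f x' y')\<^sup>2 + (f x y - f x y')\<^sup>2 + (f x' y - f x' y')\<^sup>2)"
  proof (intro sum_mono)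
    fix x x' y y'
    \<comment> \<open>For a rectangle of four values, the squared sides exceed the squared diagonals
      by exactly this square. Summed up, both diagonals contribute equally, and so do opposite
      sides, whence a factor 2 cancels.\<close>
    have "0 \<le> (f x y - f x' y - f x y' + f x' y')\<^sup>2" by simp
    then show "(f x y - f x' y')\<^sup>2 + (f x y' - f x' y)\<^sup>2 \<le>
        (f x y - f x' y)\<^sup>2 + (f x y' - f x' y')\<^sup>2 + (f x y - f x y')\<^sup>2 + (f x' y - f x' y')\<^sup>2"
      by (simp add: power2_eq_square algebra_simps)
  qed
  then show ?thesis
    unfolding L1 A1 B1 using L2 A2 B2 by (simp add: sum.distrib)
qed

text \<open>The variance splits over the coordinates by \<open>variance_product\<close>, each factor
  inequality is applied with the other coordinate fixed, and the two resulting forms sit inside the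
  Dirichlet form of \<open>S\<close>, because a swap of one coordinate is a swap of the
  image.\<close>

lemma poincare_product:
  assumes S1: "poincare C S1" "finite S1" and S2: "poincare C S2" "finite S2"
    and bij: "bij_betw (case_prod \<phi>) (S1 \<times> S2) S"
    and swap1: "\<And>x x' y. x \<in> S1 \<Longrightarrow> x' \<in> S1 \<Longrightarrow> y \<in> S2 \<Longrightarrow> swap x x' \<Longrightarrow> swap (\<phi> x y) (\<phi> x' y)"
    and swap2: "\<And>x y y'. x \<in> S1 \<Longrightarrow> y \<in> S2 \<Longrightarrow> y' \<in> S2 \<Longrightarrow> swap y y' \<Longrightarrow> swap (\<phi> x y) (\<phi> x y')"
    and C: "C \<ge> 0"
  shows "poincare C S"
  unfolding poincare_def
proof
  fix f :: "bigraph \<Rightarrow> real"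
  define g where "g x y = f (\<phi> x y)" for x y
  have reindex: "(\<Sum>z\<in>S. h z) = (\<Sum>x\<in>S1. \<Sum>y\<in>S2. h (\<phi> x y))" for h :: "bigraph \<Rightarrow> real"
    using sum.reindex_bij_betw[OF bij, of h] by (simp add: sum.cartesian_product case_prod_beta')
  have card: "card S = card S1 * card S2"
    using bij_betw_same_card[OF bij] by (simp add: card_cartesian_product)
  define E1 where "E1 = (\<Sum>y\<in>S2. \<Sum>x\<in>S1. \<Sum>x'\<in>S1. of_bool (swap x x') * (g x y - g x' y)\<^sup>2)"
  define E2 where "E2 = (\<Sum>x\<in>S1. \<Sum>y\<in>S2. \<Sum>y'\<in>S2. of_bool (swap y y') * (g x y - g x y')\<^sup>2)"
  define E where "E = (\<Sum>x\<in>S1. \<Sum>y\<in>S2. \<Sum>x'\<in>S1. \<Sum>y'\<in>S2.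
    of_bool (swap (\<phi> x y) (\<phi> x' y')) * (g x y - g x' y')\<^sup>2)"
  have "(\<Sum>y\<in>S2. \<Sum>x\<in>S1. \<Sum>x'\<in>S1. (g x y - g x' y)\<^sup>2) \<le> (\<Sum>y\<in>S2. C * card S1 *
      (\<Sum>x\<in>S1. \<Sum>x'\<in>S1. of_bool (swap x x') * (g x y - g x' y)\<^sup>2))"
    using S1(1) by (intro sum_mono) (simp add: poincare_def)
  then have V1: "(\<Sum>y\<in>S2. \<Sum>x\<in>S1. \<Sum>x'\<in>S1. (g x y - g x' y)\<^sup>2) \<le> C * card S1 * E1"
    by (simp add: E1_def sum_distrib_left)
  have "(\<Sum>x\<in>S1. \<Sum>y\<in>S2. \<Sum>y'\<in>S2. (g x y - g x y')\<^sup>2) \<le> (\<Sum>x\<in>S1. C * card S2 *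
      (\<Sum>y\<in>S2. \<Sum>y'\<in>S2. of_bool (swap y y') * (g x y - g x y')\<^sup>2))"
    using S2(1) by (intro sum_mono) (simp add: poincare_def)
  then have V2: "(\<Sum>x\<in>S1. \<Sum>y\<in>S2. \<Sum>y'\<in>S2. (g x y - g x y')\<^sup>2) \<le> C * card S2 * E2"
    by (simp add: E2_def sum_distrib_left)
  have E: "E1 + E2 \<le> E"
  proof -
    have "E1 = (\<Sum>x\<in>S1. \<Sum>y\<in>S2. \<Sum>x'\<in>S1. of_bool (swap x x') * (g x y - g x' y)\<^sup>2)"
      unfolding E1_def by (rule sum.swap)
    also have "\<dots> = (\<Sum>x\<in>S1. \<Sum>y\<in>S2. \<Sum>x'\<in>S1. \<Sum>y'\<in>S2.
        of_bool (y' = y) * of_bool (swap x x') * (g x y - g x' y)\<^sup>2)"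
      using S2(2) by (simp add: of_bool_def if_distrib[of "\<lambda>u. u * _"] cong: if_cong)
    finally have 1: "E1 = \<dots>" .
    have 2: "E2 = (\<Sum>x\<in>S1. \<Sum>y\<in>S2. \<Sum>x'\<in>S1. \<Sum>y'\<in>S2.
        of_bool (x' = x) * of_bool (swap y y') * (g x y - g x y')\<^sup>2)"
      unfolding E2_def
    proof (rule sum.cong[OF refl], rule sum.cong[OF refl])
      fix x y assume "x \<in> S1" "y \<in> S2"
      have "(\<Sum>x'\<in>S1. \<Sum>y'\<in>S2. of_bool (x' = x) * of_bool (swap y y') * (g x y - g x y')\<^sup>2) =
          (\<Sum>x'\<in>S1. if x' = x then (\<Sum>y'\<in>S2. of_bool (swap y y') * (g x y - g x y')\<^sup>2) else 0)"
        by (intro sum.cong refl) auto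
      then show "(\<Sum>y'\<in>S2. of_bool (swap y y') * (g x y - g x y')\<^sup>2) =
          (\<Sum>x'\<in>S1. \<Sum>y'\<in>S2. of_bool (x' = x) * of_bool (swap y y') * (g x y - g x y')\<^sup>2)"
        using S1(2) \<open>x \<in> S1\<close> by simp
    qed
    \<comment> \<open>The two terms on the left are never nonzero together: that would need both
      coordinates unchanged, and \<open>swap\<close> is irreflexive.\<close>
    have "of_bool (y' = y) * of_bool (swap x x') * (g x y - g x' y)\<^sup>2 +
        of_bool (x' = x) * of_bool (swap y y') * (g x y - g x y')\<^sup>2
        \<le> of_bool (swap (\<phi> x y) (\<phi> x' y')) * (g x y - g x' y')\<^sup>2"
      if "x \<in> S1" "y \<in> S2" "x' \<in> S1" "y' \<in> S2" for x x' y y'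
      using that swap1[of x x' y] swap2[of x y y'] swap_irrefl
      by (cases "x' = x"; cases "y' = y") (auto simp: of_bool_def)
    then show ?thesis
      unfolding 1 2 E_def sum.distrib[symmetric] by (intro sum_mono)
  qed
  have "(\<Sum>z\<in>S. \<Sum>z'\<in>S. (f z - f z')\<^sup>2) = (\<Sum>x\<in>S1. \<Sum>y\<in>S2. \<Sum>x'\<in>S1. \<Sum>y'\<in>S2. (g x y - g x' y')\<^sup>2)"
    by (simp add: reindex g_def)
  also have "\<dots> \<le> card S2 * (C * card S1 * E1) + card S1 * (C * card S2 * E2)"
    using V1 V2
    by (intro order.trans[OF variance_product] add_mono mult_left_mono) auto
  also have "\<dots> = C * card S * (E1 + E2)"
    by (simp add: card algebra_simps)
  also have "\<dots> \<le> C * card S * E"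
    using E C by (intro mult_left_mono) auto
  also have "E = (\<Sum>z\<in>S. \<Sum>z'\<in>S. of_bool (swap z z') * (f z - f z')\<^sup>2)"
    by (simp add: reindex g_def E_def)
  finally show "(\<Sum>z\<in>S. \<Sum>z'\<in>S. (f z - f z')\<^sup>2) \<le>
      C * card S * (\<Sum>z\<in>S. \<Sum>z'\<in>S. of_bool (swap z z') * (f z - f z')\<^sup>2)" .
qed

section \<open>Composition of degree sequences\<close>

lemma card_Int_Times:
  assumes "finite X" "finite Y"
  shows "card (G \<inter> X \<times> Y) = (\<Sum>x\<in>X. card {y\<in>Y. (x, y) \<in> G})"
    and "card (G \<inter> X \<times> Y) = (\<Sum>y\<in>Y. card {x\<in>X. (x, y) \<in> G})"
proof -
  have "G \<inter> X \<times> Y = (SIGMA x:X. {y\<in>Y. (x, y) \<in> G})" by auto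
  then show "card (G \<inter> X \<times> Y) = (\<Sum>x\<in>X. card {y\<in>Y. (x, y) \<in> G})"
    using assms by simp
  have "bij_betw prod.swap (G \<inter> X \<times> Y) (SIGMA y:Y. {x\<in>X. (x, y) \<in> G})"
    by (rule bij_betw_byWitness[where f' = prod.swap]) auto
  then show "card (G \<inter> X \<times> Y) = (\<Sum>y\<in>Y. card {x\<in>X. (x, y) \<in> G})"
    using assms by (simp add: bij_betw_same_card)
qed

lemma marg_realizations_cong:
  assumes "\<And>x. x \<in> X \<Longrightarrow> d x = d' x" "\<And>y. y \<in> Y \<Longrightarrow> e y = e' y"
  shows "marg_realizations X Y d e = marg_realizations X Y d' e'"
  using assms by (auto simp: marg_realizations_def)

lemma marg_realizations_sums:
  assumes "G \<in> marg_realizations X Y d e" "finite X" "finite Y"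
  shows "card G = sum d X" "card G = sum e Y"
proof -
  have G: "G \<inter> X \<times> Y = G" using assms(1) by (auto simp: marg_realizations_def)
  have "{y\<in>Y. (x, y) \<in> G} = {y. (x, y) \<in> G}" "{x\<in>X. (x, y) \<in> G} = {x. (x, y) \<in> G}" for x y
    using G by auto
  then show "card G = sum d X" "card G = sum e Y"
    using card_Int_Times[OF assms(2,3), of G] G assms(1) by (auto simp: marg_realizations_def)
qed

lemma marg_realizations_le:
  assumes "G \<in> marg_realizations X Y d e" "finite X" "finite Y"
  shows "x \<in> X \<Longrightarrow> d x \<le> card Y" "y \<in> Y \<Longrightarrow> e y \<le> card X"
proof -
  have "card {y. (x, y) \<in> G} \<le> card Y" "card {x. (x, y) \<in> G} \<le> card X" for x y
    using assms by (auto simp: marg_realizations_def intro!: card_mono)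
  moreover have "x \<in> X \<Longrightarrow> d x = card {y. (x, y) \<in> G}" "y \<in> Y \<Longrightarrow> e y = card {x. (x, y) \<in> G}"
    using assms(1) by (simp_all add: marg_realizations_def)
  ultimately show "x \<in> X \<Longrightarrow> d x \<le> card Y" "y \<in> Y \<Longrightarrow> e y \<le> card X" by metis+
qed

text \<open>The summands \<open>card Y2\<close> and \<open>card X1\<close> account for the complete
  rectangle \<open>X1 \<times> Y2\<close>. A realization of the first block is assumed because it
  makes \<open>d1\<close> and \<open>e1\<close> have equal sums, on which the forcing argument
  rests.\<close>

locale composition =
  fixes X1 X2 Y1 Y2 :: "nat set" and d1 e1 d2 e2 d e :: "nat \<Rightarrow> nat"
  assumes fin: "finite X1" "finite X2" "finite Y1" "finite Y2"
    and disj: "X1 \<inter> X2 = {}" "Y1 \<inter> Y2 = {}"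
    and d: "\<And>x. x \<in> X1 \<Longrightarrow> d x = d1 x + card Y2" "\<And>x. x \<in> X2 \<Longrightarrow> d x = d2 x"
    and e: "\<And>y. y \<in> Y1 \<Longrightarrow> e y = e1 y" "\<And>y. y \<in> Y2 \<Longrightarrow> e y = e2 y + card X1"
    and nonempty: "marg_realizations X1 Y1 d1 e1 \<noteq> {}"
begin

lemma fin_Un: "finite (X1 \<union> X2)" "finite (Y1 \<union> Y2)"
  using fin by auto

lemma realization_composition:
  assumes "G1 \<in> marg_realizations X1 Y1 d1 e1" "G2 \<in> marg_realizations X2 Y2 d2 e2"
  shows "G1 \<union> G2 \<union> X1 \<times> Y2 \<in> marg_realizations (X1 \<union> X2) (Y1 \<union> Y2) d e"
proof -
  have G: "G1 \<subseteq> X1 \<times> Y1" "G2 \<subseteq> X2 \<times> Y2" using assms by (auto simp: marg_realizations_def)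
  have fin': "finite {y. (x, y) \<in> G1}" "finite {x. (x, y) \<in> G2}" for x y
    using G fin by (auto intro: finite_subset[of _ Y1] finite_subset[of _ X2])
  have "card {y. (x, y) \<in> G1 \<union> G2 \<union> X1 \<times> Y2} = d x" if "x \<in> X1" for x
  proof -
    have "{y. (x, y) \<in> G1 \<union> G2 \<union> X1 \<times> Y2} = {y. (x, y) \<in> G1} \<union> Y2"
      using that G disj by auto
    also have "card \<dots> = card {y. (x, y) \<in> G1} + card Y2"
      using fin fin' G disj by (intro card_Un_disjoint) auto
    finally show ?thesis using that assms by (auto simp: d marg_realizations_def)
  qed
  moreover have "card {y. (x, y) \<in> G1 \<union> G2 \<union> X1 \<times> Y2} = d x" if "x \<in> X2" for x
  proof -
    have "{y. (x, y) \<in> G1 \<union> G2 \<union> X1 \<times> Y2} = {y. (x, y) \<in> G2}"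
      using that G disj by auto
    then show ?thesis using that assms by (auto simp: d marg_realizations_def)
  qed
  moreover have "card {x. (x, y) \<in> G1 \<union> G2 \<union> X1 \<times> Y2} = e y" if "y \<in> Y2" for y
  proof -
    have "{x. (x, y) \<in> G1 \<union> G2 \<union> X1 \<times> Y2} = {x. (x, y) \<in> G2} \<union> X1"
      using that G disj by auto
    also have "card \<dots> = card {x. (x, y) \<in> G2} + card X1"
      using fin fin' G disj by (intro card_Un_disjoint) auto
    finally show ?thesis using that assms by (auto simp: e marg_realizations_def)
  qed
  moreover have "card {x. (x, y) \<in> G1 \<union> G2 \<union> X1 \<times> Y2} = e y" if "y \<in> Y1" for y
  proof -
    have "{x. (x, y) \<in> G1 \<union> G2 \<union> X1 \<times> Y2} = {x. (x, y) \<in> G1}"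
      using that G disj by auto
    then show ?thesis using that assms by (auto simp: e marg_realizations_def)
  qed
  moreover have "G1 \<union> G2 \<union> X1 \<times> Y2 \<subseteq> (X1 \<union> X2) \<times> (Y1 \<union> Y2)" using G by auto
  ultimately show ?thesis by (auto simp: marg_realizations_def)
qed

text \<open>Counting the edges at \<open>X1\<close> and at \<open>Y1\<close> shows that the degrees force all pairs in \<open>X1 \<times> Y2\<close>
  to be edges and all pairs in \<open>X2 \<times> Y1\<close> to be non-edges.\<close>

lemma realization_forced:
  assumes G: "G \<in> marg_realizations (X1 \<union> X2) (Y1 \<union> Y2) d e"
  shows "X1 \<times> Y2 \<subseteq> G" "G \<inter> X2 \<times> Y1 = {}"
proof -
  obtain G1 where G1: "G1 \<in> marg_realizations X1 Y1 d1 e1" using nonempty by auto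
  have sub: "G \<subseteq> (X1 \<union> X2) \<times> (Y1 \<union> Y2)" using G by (simp add: marg_realizations_def)
  have nb: "{y\<in>Y1 \<union> Y2. (x, y) \<in> G} = {y. (x, y) \<in> G}" "{x\<in>X1 \<union> X2. (x, y) \<in> G} = {x. (x, y) \<in> G}" for x y
    using sub by auto
  have "card (G \<inter> X1 \<times> (Y1 \<union> Y2)) = (\<Sum>x\<in>X1. d1 x + card Y2)"
    unfolding card_Int_Times(1)[OF fin(1) fin_Un(2)] nb
    using G by (intro sum.cong) (auto simp: marg_realizations_def d)
  also have "\<dots> = card G1 + card X1 * card Y2"
    using marg_realizations_sums[OF G1] fin by (simp add: sum.distrib)
  also have "G \<inter> X1 \<times> (Y1 \<union> Y2) = (G \<inter> X1 \<times> Y1) \<union> (G \<inter> X1 \<times> Y2)" by auto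
  also have "card \<dots> = card (G \<inter> X1 \<times> Y1) + card (G \<inter> X1 \<times> Y2)"
    using fin disj by (intro card_Un_disjoint) auto
  finally have 1: "card (G \<inter> X1 \<times> Y1) + card (G \<inter> X1 \<times> Y2) = card G1 + card X1 * card Y2" .
  have "card (G \<inter> (X1 \<union> X2) \<times> Y1) = (\<Sum>y\<in>Y1. e1 y)"
    unfolding card_Int_Times(2)[OF fin_Un(1) fin(3)] nb
    using G by (intro sum.cong) (auto simp: marg_realizations_def e)
  also have "\<dots> = card G1"
    using marg_realizations_sums[OF G1] fin by simp
  also have "G \<inter> (X1 \<union> X2) \<times> Y1 = (G \<inter> X1 \<times> Y1) \<union> (G \<inter> X2 \<times> Y1)" by auto
  also have "card \<dots> = card (G \<inter> X1 \<times> Y1) + card (G \<inter> X2 \<times> Y1)"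
    using fin disj by (intro card_Un_disjoint) auto
  \<comment> \<open>Eliminating the edges in \<open>X1 \<times> Y1\<close> from the two counts, any
    edge in \<open>X2 \<times> Y1\<close> would require more edges in \<open>X1 \<times> Y2\<close>
    than there are pairs.\<close>
  finally have 2: "card (G \<inter> X1 \<times> Y2) = card (X1 \<times> Y2) + card (G \<inter> X2 \<times> Y1)"
    using 1 by (simp add: card_cartesian_product)
  moreover have 3: "card (G \<inter> X1 \<times> Y2) \<le> card (X1 \<times> Y2)"
    using fin by (intro card_mono) auto
  ultimately show "G \<inter> X2 \<times> Y1 = {}" using fin by simp
  have "G \<inter> X1 \<times> Y2 = X1 \<times> Y2"
    using 2 3 fin by (intro card_subset_eq) auto
  then show "X1 \<times> Y2 \<subseteq> G" by auto
qed

lemma realization_decomposition: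
  assumes G: "G \<in> marg_realizations (X1 \<union> X2) (Y1 \<union> Y2) d e"
  shows "G \<inter> X1 \<times> Y1 \<in> marg_realizations X1 Y1 d1 e1"
    and "G \<inter> X2 \<times> Y2 \<in> marg_realizations X2 Y2 d2 e2"
    and "G = G \<inter> X1 \<times> Y1 \<union> G \<inter> X2 \<times> Y2 \<union> X1 \<times> Y2"
proof -
  note forced = realization_forced[OF G]
  have sub: "G \<subseteq> (X1 \<union> X2) \<times> (Y1 \<union> Y2)" using G by (simp add: marg_realizations_def)
  then show eq: "G = G \<inter> X1 \<times> Y1 \<union> G \<inter> X2 \<times> Y2 \<union> X1 \<times> Y2"
    using forced by auto
  have finG: "finite {y. (x, y) \<in> G \<inter> X1 \<times> Y1}" "finite {x. (x, y) \<in> G \<inter> X2 \<times> Y2}" for x y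
    using fin by (auto intro: finite_subset[of _ Y1] finite_subset[of _ X2])
  have "card {y. (x, y) \<in> G \<inter> X1 \<times> Y1} = d1 x" if "x \<in> X1" for x
  proof -
    have "{y. (x, y) \<in> G} = {y. (x, y) \<in> G \<inter> X1 \<times> Y1} \<union> Y2"
      using that disj sub forced by auto
    also have "card \<dots> = card {y. (x, y) \<in> G \<inter> X1 \<times> Y1} + card Y2"
      using finG disj fin by (intro card_Un_disjoint) auto
    finally show ?thesis using that G by (auto simp: d marg_realizations_def)
  qed
  moreover have "card {y. (x, y) \<in> G \<inter> X2 \<times> Y2} = d2 x" if "x \<in> X2" for x
  proof -
    have "{y. (x, y) \<in> G \<inter> X2 \<times> Y2} = {y. (x, y) \<in> G}"
      using that disj sub forced by auto
    also have "card \<dots> = d2 x" using that G by (auto simp: d marg_realizations_def)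
    finally show ?thesis .
  qed
  moreover have "card {x. (x, y) \<in> G \<inter> X2 \<times> Y2} = e2 y" if "y \<in> Y2" for y
  proof -
    have "{x. (x, y) \<in> G} = {x. (x, y) \<in> G \<inter> X2 \<times> Y2} \<union> X1"
      using that disj sub forced by auto
    also have "card \<dots> = card {x. (x, y) \<in> G \<inter> X2 \<times> Y2} + card X1"
      using finG disj fin by (intro card_Un_disjoint) auto
    finally show ?thesis using that G by (auto simp: e marg_realizations_def)
  qed
  moreover have "card {x. (x, y) \<in> G \<inter> X1 \<times> Y1} = e1 y" if "y \<in> Y1" for y
  proof -
    have "{x. (x, y) \<in> G \<inter> X1 \<times> Y1} = {x. (x, y) \<in> G}"
      using that disj sub forced by auto
    also have "card \<dots> = e1 y" using that G by (auto simp: e marg_realizations_def)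
    finally show ?thesis .
  qed
  ultimately show "G \<inter> X1 \<times> Y1 \<in> marg_realizations X1 Y1 d1 e1"
    "G \<inter> X2 \<times> Y2 \<in> marg_realizations X2 Y2 d2 e2"
    by (auto simp: marg_realizations_def)
qed

lemma bij_betw_composition:
  "bij_betw (\<lambda>(G1, G2). G1 \<union> G2 \<union> X1 \<times> Y2)
    (marg_realizations X1 Y1 d1 e1 \<times> marg_realizations X2 Y2 d2 e2)
    (marg_realizations (X1 \<union> X2) (Y1 \<union> Y2) d e)"
proof (rule bij_betw_byWitness[where f' = "\<lambda>G. (G \<inter> X1 \<times> Y1, G \<inter> X2 \<times> Y2)"])
  show "\<forall>p\<in>marg_realizations X1 Y1 d1 e1 \<times> marg_realizations X2 Y2 d2 e2.
      (\<lambda>G. (G \<inter> X1 \<times> Y1, G \<inter> X2 \<times> Y2)) ((\<lambda>(G1, G2). G1 \<union> G2 \<union> X1 \<times> Y2) p) = p"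
  proof
    fix p assume "p \<in> marg_realizations X1 Y1 d1 e1 \<times> marg_realizations X2 Y2 d2 e2"
    then obtain G1 G2 where p: "p = (G1, G2)" "G1 \<subseteq> X1 \<times> Y1" "G2 \<subseteq> X2 \<times> Y2"
      by (auto simp: marg_realizations_def)
    then have "(G1 \<union> G2 \<union> X1 \<times> Y2) \<inter> X1 \<times> Y1 = G1" "(G1 \<union> G2 \<union> X1 \<times> Y2) \<inter> X2 \<times> Y2 = G2"
      using disj by auto
    then show "(\<lambda>G. (G \<inter> X1 \<times> Y1, G \<inter> X2 \<times> Y2)) ((\<lambda>(G1, G2). G1 \<union> G2 \<union> X1 \<times> Y2) p) = p"
      by (simp add: p(1))
  qed
  show "\<forall>G\<in>marg_realizations (X1 \<union> X2) (Y1 \<union> Y2) d e.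
      (\<lambda>(G1, G2). G1 \<union> G2 \<union> X1 \<times> Y2) (G \<inter> X1 \<times> Y1, G \<inter> X2 \<times> Y2) = G"
    using realization_decomposition(3) by simp
  show "(\<lambda>(G1, G2). G1 \<union> G2 \<union> X1 \<times> Y2) `
      (marg_realizations X1 Y1 d1 e1 \<times> marg_realizations X2 Y2 d2 e2)
      \<subseteq> marg_realizations (X1 \<union> X2) (Y1 \<union> Y2) d e"
    by (rule image_subsetI) (simp add: case_prod_beta mem_Times_iff realization_composition)
  show "(\<lambda>G. (G \<inter> X1 \<times> Y1, G \<inter> X2 \<times> Y2)) ` marg_realizations (X1 \<union> X2) (Y1 \<union> Y2) d e
      \<subseteq> marg_realizations X1 Y1 d1 e1 \<times> marg_realizations X2 Y2 d2 e2"
    by (rule image_subsetI) (simp add: realization_decomposition(1,2))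
qed

lemma poincare_composition:
  assumes "poincare C (marg_realizations X1 Y1 d1 e1)" "poincare C (marg_realizations X2 Y2 d2 e2)"
    and "C \<ge> 0"
  shows "poincare C (marg_realizations (X1 \<union> X2) (Y1 \<union> Y2) d e)"
proof (rule poincare_product[OF assms(1) _ assms(2) _ bij_betw_composition _ _ assms(3)])
  fix G1 G1' G2
  assume *: "G1 \<in> marg_realizations X1 Y1 d1 e1" "G2 \<in> marg_realizations X2 Y2 d2 e2" "swap G1 G1'"
  then have "G1 \<subseteq> X1 \<times> Y1" "G2 \<subseteq> X2 \<times> Y2" by (auto simp: marg_realizations_def)
  then have "swap (G1 \<union> (G2 \<union> X1 \<times> Y2)) (G1' \<union> (G2 \<union> X1 \<times> Y2))"
    using *(3) disj by (intro swap_add[where X = X1 and Y = Y1]) auto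
  then show "swap (G1 \<union> G2 \<union> X1 \<times> Y2) (G1' \<union> G2 \<union> X1 \<times> Y2)" by (simp add: Un_assoc)
next
  fix G1 G2 G2'
  assume *: "G1 \<in> marg_realizations X1 Y1 d1 e1" "G2 \<in> marg_realizations X2 Y2 d2 e2" "swap G2 G2'"
  then have "G1 \<subseteq> X1 \<times> Y1" "G2 \<subseteq> X2 \<times> Y2" by (auto simp: marg_realizations_def)
  then have "swap (G2 \<union> (G1 \<union> X1 \<times> Y2)) (G2' \<union> (G1 \<union> X1 \<times> Y2))"
    using *(3) disj by (intro swap_add[where X = X2 and Y = Y2]) auto
  then show "swap (G1 \<union> G2 \<union> X1 \<times> Y2) (G1 \<union> G2' \<union> X1 \<times> Y2)" by (simp add: Un_ac)
qed (simp_all add: fin marg_realizations_finite(1))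

end

section \<open>Invariance under renaming the vertices of either class\<close>

text \<open>The blocks of a composition occupy arbitrary vertex subsets. Renaming shows that their
  number, together with the Poincare constant and the number of realizations, depends only on the
  block sizes.\<close>

locale relabelling =
  fixes X X' Y Y' :: "nat set" and \<alpha> \<beta> d d' e e' :: "nat \<Rightarrow> nat"
  assumes fin: "finite X" "finite Y"
    and \<alpha>: "bij_betw \<alpha> X X'" and \<beta>: "bij_betw \<beta> Y Y'"
    and d: "\<And>x. x \<in> X \<Longrightarrow> d' (\<alpha> x) = d x" and e: "\<And>y. y \<in> Y \<Longrightarrow> e' (\<beta> y) = e y"
begin

lemma relabel_iff:
  assumes "G \<subseteq> X \<times> Y" "x \<in> X" "y \<in> Y"
  shows "(\<alpha> x, \<beta> y) \<in> map_prod \<alpha> \<beta> ` G \<longleftrightarrow> (x, y) \<in> G"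
proof
  assume "(\<alpha> x, \<beta> y) \<in> map_prod \<alpha> \<beta> ` G"
  then obtain u v where uv: "(u, v) \<in> G" "\<alpha> x = \<alpha> u" "\<beta> y = \<beta> v" by auto
  then have "u \<in> X" "v \<in> Y" using assms(1) by auto
  then have "x = u" "y = v"
    using uv assms(2,3) bij_betw_imp_inj_on[OF \<alpha>] bij_betw_imp_inj_on[OF \<beta>]
    by (simp_all add: inj_on_eq_iff)
  with uv show "(x, y) \<in> G" by simp
next
  assume "(x, y) \<in> G"
  then show "(\<alpha> x, \<beta> y) \<in> map_prod \<alpha> \<beta> ` G"
    using imageI[of "(x, y)" G "map_prod \<alpha> \<beta>"] by simp
qed

lemma bij_betw_relabel:
  "bij_betw ((`) (map_prod \<alpha> \<beta>)) (marg_realizations X Y d e) (marg_realizations X' Y' d' e')"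
proof (rule bij_betw_byWitness[where f' = "\<lambda>H. {(x, y). x \<in> X \<and> y \<in> Y \<and> (\<alpha> x, \<beta> y) \<in> H}"])
  have X': "X' = \<alpha> ` X" and Y': "Y' = \<beta> ` Y" using \<alpha> \<beta> by (auto simp: bij_betw_def)
  have card_\<alpha>: "card (\<alpha> ` A) = card A" if "A \<subseteq> X" for A
    using bij_betw_same_card[OF bij_betw_subset[OF \<alpha> that]] by simp
  have card_\<beta>: "card (\<beta> ` B) = card B" if "B \<subseteq> Y" for B
    using bij_betw_same_card[OF bij_betw_subset[OF \<beta> that]] by simp
  show "\<forall>G\<in>marg_realizations X Y d e.
      {(x, y). x \<in> X \<and> y \<in> Y \<and> (\<alpha> x, \<beta> y) \<in> map_prod \<alpha> \<beta> ` G} = G"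
  proof
    fix G assume "G \<in> marg_realizations X Y d e"
    then have sub: "G \<subseteq> X \<times> Y" by (simp add: marg_realizations_def)
    show "{(x, y). x \<in> X \<and> y \<in> Y \<and> (\<alpha> x, \<beta> y) \<in> map_prod \<alpha> \<beta> ` G} = G"
    proof (intro equalityI subsetI)
      fix p assume "p \<in> {(x, y). x \<in> X \<and> y \<in> Y \<and> (\<alpha> x, \<beta> y) \<in> map_prod \<alpha> \<beta> ` G}"
      then show "p \<in> G" using relabel_iff[OF sub, of "fst p" "snd p"] by (simp add: case_prod_beta)
    next
      fix p assume "p \<in> G"
      then show "p \<in> {(x, y). x \<in> X \<and> y \<in> Y \<and> (\<alpha> x, \<beta> y) \<in> map_prod \<alpha> \<beta> ` G}"
        using relabel_iff[OF sub, of "fst p" "snd p"] subsetD[OF sub]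
        by (simp add: case_prod_beta mem_Times_iff)
    qed
  qed
  show "\<forall>H\<in>marg_realizations X' Y' d' e'.
      map_prod \<alpha> \<beta> ` {(x, y). x \<in> X \<and> y \<in> Y \<and> (\<alpha> x, \<beta> y) \<in> H} = H"
  proof
    fix H assume "H \<in> marg_realizations X' Y' d' e'"
    then have "H \<subseteq> \<alpha> ` X \<times> \<beta> ` Y" by (simp add: marg_realizations_def X' Y')
    then show "map_prod \<alpha> \<beta> ` {(x, y). x \<in> X \<and> y \<in> Y \<and> (\<alpha> x, \<beta> y) \<in> H} = H"
      by (fastforce simp: image_iff)
  qed
  show "(`) (map_prod \<alpha> \<beta>) ` marg_realizations X Y d e \<subseteq> marg_realizations X' Y' d' e'"
  proof (rule image_subsetI)
    fix G assume G: "G \<in> marg_realizations X Y d e"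
    then have sub: "G \<subseteq> X \<times> Y" by (simp add: marg_realizations_def)
    have "{y'. (\<alpha> x, y') \<in> map_prod \<alpha> \<beta> ` G} = \<beta> ` {y. (x, y) \<in> G}" if "x \<in> X" for x
    proof (intro equalityI subsetI)
      fix y' assume "y' \<in> {y'. (\<alpha> x, y') \<in> map_prod \<alpha> \<beta> ` G}"
      then obtain u v where uv: "(u, v) \<in> G" "\<alpha> x = \<alpha> u" "y' = \<beta> v" by auto
      moreover have "u \<in> X" using uv sub by auto
      then have "x = u" using uv(2) that inj_onD[OF bij_betw_imp_inj_on[OF \<alpha>]] by blast
      ultimately show "y' \<in> \<beta> ` {y. (x, y) \<in> G}" by simp
    qed (use imageI[of _ G "map_prod \<alpha> \<beta>"] in force)
    then have "card {y'. (\<alpha> x, y') \<in> map_prod \<alpha> \<beta> ` G} = d' (\<alpha> x)" if "x \<in> X" for x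
      using that sub G card_\<beta>[of "{y. (x, y) \<in> G}"] by (auto simp: d marg_realizations_def)
    moreover have "{x'. (x', \<beta> y) \<in> map_prod \<alpha> \<beta> ` G} = \<alpha> ` {x. (x, y) \<in> G}" if "y \<in> Y" for y
    proof (intro equalityI subsetI)
      fix x' assume "x' \<in> {x'. (x', \<beta> y) \<in> map_prod \<alpha> \<beta> ` G}"
      then obtain u v where uv: "(u, v) \<in> G" "x' = \<alpha> u" "\<beta> y = \<beta> v" by auto
      moreover have "v \<in> Y" using uv sub by auto
      then have "y = v" using uv(3) that inj_onD[OF bij_betw_imp_inj_on[OF \<beta>]] by blast
      ultimately show "x' \<in> \<alpha> ` {x. (x, y) \<in> G}" by simp
    qed (use imageI[of _ G "map_prod \<alpha> \<beta>"] in force)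
    then have "card {x'. (x', \<beta> y) \<in> map_prod \<alpha> \<beta> ` G} = e' (\<beta> y)" if "y \<in> Y" for y
      using that sub G card_\<alpha>[of "{x. (x, y) \<in> G}"] by (auto simp: e marg_realizations_def)
    moreover have "map_prod \<alpha> \<beta> ` G \<subseteq> X' \<times> Y'" using sub by (auto simp: X' Y')
    ultimately show "map_prod \<alpha> \<beta> ` G \<in> marg_realizations X' Y' d' e'"
      unfolding marg_realizations_def X' Y' by blast
  qed
  show "(\<lambda>H. {(x, y). x \<in> X \<and> y \<in> Y \<and> (\<alpha> x, \<beta> y) \<in> H}) ` marg_realizations X' Y' d' e'
      \<subseteq> marg_realizations X Y d e"
  proof (rule image_subsetI)
    fix H assume H: "H \<in> marg_realizations X' Y' d' e'"
    then have sub: "H \<subseteq> \<alpha> ` X \<times> \<beta> ` Y" by (simp add: marg_realizations_def X' Y')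
    let ?G = "{(x, y). x \<in> X \<and> y \<in> Y \<and> (\<alpha> x, \<beta> y) \<in> H}"
    have "card {y. (x, y) \<in> ?G} = d x" if x: "x \<in> X" for x
    proof -
      have "{y'. (\<alpha> x, y') \<in> H} = \<beta> ` {y. (x, y) \<in> ?G}" using sub x by auto
      then have "card {y. (x, y) \<in> ?G} = card {y'. (\<alpha> x, y') \<in> H}"
        using card_\<beta>[of "{y. (x, y) \<in> ?G}"] by (simp add: subset_iff)
      then show ?thesis using H x d by (auto simp: marg_realizations_def X')
    qed
    moreover have "card {x. (x, y) \<in> ?G} = e y" if y: "y \<in> Y" for y
    proof -
      have "{x'. (x', \<beta> y) \<in> H} = \<alpha> ` {x. (x, y) \<in> ?G}" using sub y by auto
      then have "card {x. (x, y) \<in> ?G} = card {x'. (x', \<beta> y) \<in> H}"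
        using card_\<alpha>[of "{x. (x, y) \<in> ?G}"] by (simp add: subset_iff)
      then show ?thesis using H y e by (auto simp: marg_realizations_def Y')
    qed
    ultimately show "?G \<in> marg_realizations X Y d e"
      unfolding marg_realizations_def by blast
  qed
qed

lemma swap_relabel:
  assumes "G \<in> marg_realizations X Y d e" "H \<in> marg_realizations X Y d e" "swap G H"
  shows "swap (map_prod \<alpha> \<beta> ` G) (map_prod \<alpha> \<beta> ` H)"
  using assms(3)
proof (rule swapE)
  fix a b c d
  assume *: "(a, c) \<in> G" "(b, d) \<in> G" "(b, c) \<notin> G" "(a, d) \<notin> G"
    "H = G - {(a, c), (b, d)} \<union> {(b, c), (a, d)}" "a \<noteq> b" "c \<noteq> d"
  have sub: "G \<subseteq> X \<times> Y" "H \<subseteq> X \<times> Y" using assms by (auto simp: marg_realizations_def)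
  then have mem: "a \<in> X" "b \<in> X" "c \<in> Y" "d \<in> Y" using * by auto
  have inj: "inj_on (map_prod \<alpha> \<beta>) (X \<times> Y)"
    using \<alpha> \<beta> by (auto simp: bij_betw_def intro: map_prod_inj_on)
  have "map_prod \<alpha> \<beta> ` (G - {(a, c), (b, d)}) =
      map_prod \<alpha> \<beta> ` G - map_prod \<alpha> \<beta> ` {(a, c), (b, d)}"
    using sub mem by (intro inj_on_image_set_diff[OF inj]) auto
  then have "map_prod \<alpha> \<beta> ` H = map_prod \<alpha> \<beta> ` G - {(\<alpha> a, \<beta> c), (\<alpha> b, \<beta> d)} \<union> {(\<alpha> b, \<beta> c), (\<alpha> a, \<beta> d)}"
    unfolding *(5) by (simp add: image_Un)
  then show ?thesis
    using * mem by (intro swapI[of "\<alpha> a" "\<beta> c" _ "\<alpha> b" "\<beta> d"]) (auto simp: relabel_iff[OF sub(1)])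
qed

lemma poincare_relabel:
  assumes P: "poincare C (marg_realizations X Y d e)" and C: "C \<ge> 0"
  shows "poincare C (marg_realizations X' Y' d' e')"
  unfolding poincare_def
proof
  fix f :: "bigraph \<Rightarrow> real"
  let ?S = "marg_realizations X Y d e"
  define g where "g G = f (map_prod \<alpha> \<beta> ` G)" for G
  have reindex: "(\<Sum>z\<in>marg_realizations X' Y' d' e'. h z) = (\<Sum>x\<in>?S. h (map_prod \<alpha> \<beta> ` x))"
    for h :: "bigraph \<Rightarrow> real"
    using sum.reindex_bij_betw[OF bij_betw_relabel, of h] by simp
  have card: "card (marg_realizations X' Y' d' e') = card ?S"
    using bij_betw_same_card[OF bij_betw_relabel] by simp
  have "(\<Sum>x\<in>?S. \<Sum>y\<in>?S. (g x - g y)\<^sup>2) \<le> C * card ?S * (\<Sum>x\<in>?S. \<Sum>y\<in>?S. of_bool (swap x y) * (g x - g y)\<^sup>2)"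
    using P by (simp add: poincare_def)
  also have "\<dots> \<le> C * card ?S *
      (\<Sum>x\<in>?S. \<Sum>y\<in>?S. of_bool (swap (map_prod \<alpha> \<beta> ` x) (map_prod \<alpha> \<beta> ` y)) * (g x - g y)\<^sup>2)"
    using C swap_relabel by (intro mult_left_mono sum_mono mult_right_mono) (auto simp: of_bool_def)
  finally show "(\<Sum>x\<in>marg_realizations X' Y' d' e'. \<Sum>y\<in>marg_realizations X' Y' d' e'. (f x - f y)\<^sup>2)
    \<le> C * card (marg_realizations X' Y' d' e') * (\<Sum>x\<in>marg_realizations X' Y' d' e'.
      \<Sum>y\<in>marg_realizations X' Y' d' e'. of_bool (swap x y) * (f x - f y)\<^sup>2)"
    by (simp add: reindex card g_def)
qed

end

section \<open>Counting positive sequences with a prescribed Poincare constant\<close>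

text \<open>Extensional functions let each degree sequence on \<open>X\<close> and \<open>Y\<close>
  be counted once. The bound \<open>r\<close> on the number of realizations multiplies under
  composition: 1 means realizable, and 2 ensures that the chain has a second eigenvalue.\<close>

definition poincare_seqs :: "real \<Rightarrow> nat \<Rightarrow> nat set \<Rightarrow> nat set \<Rightarrow> ((nat \<Rightarrow> nat) \<times> (nat \<Rightarrow> nat)) set" where
  "poincare_seqs C r X Y = {(d, e). d \<in> extensional X \<and> e \<in> extensional Y \<and>
     (\<forall>x\<in>X. 1 \<le> d x) \<and> (\<forall>y\<in>Y. 1 \<le> e y) \<and>
     r \<le> card (marg_realizations X Y d e) \<and> poincare C (marg_realizations X Y d e)}"

lemma poincare_seqs_realization:
  assumes "(d, e) \<in> poincare_seqs C r X Y" "1 \<le> r"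
  obtains G where "G \<in> marg_realizations X Y d e"
proof -
  have "card (marg_realizations X Y d e) \<noteq> 0" using assms by (auto simp: poincare_seqs_def)
  then show ?thesis using that by (metis card.empty ex_in_conv)
qed

lemma poincare_seqs_subset:
  assumes "finite X" "finite Y" "1 \<le> r"
  shows "poincare_seqs C r X Y \<subseteq> (X \<rightarrow>\<^sub>E {1..card Y}) \<times> (Y \<rightarrow>\<^sub>E {1..card X})"
proof clarify
  fix d e assume de: "(d, e) \<in> poincare_seqs C r X Y"
  then obtain G where G: "G \<in> marg_realizations X Y d e" using assms(3) by (rule poincare_seqs_realization)
  show "d \<in> X \<rightarrow>\<^sub>E {1..card Y} \<and> e \<in> Y \<rightarrow>\<^sub>E {1..card X}"
    using marg_realizations_le[OF G assms(1,2)] de by (auto simp: poincare_seqs_def PiE_def)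
qed

lemma finite_poincare_seqs:
  assumes "finite X" "finite Y" "1 \<le> r"
  shows "finite (poincare_seqs C r X Y)"
proof (rule finite_subset)
  show "poincare_seqs C r X Y \<subseteq> (X \<rightarrow>\<^sub>E {1..card Y}) \<times> (Y \<rightarrow>\<^sub>E {1..card X})"
    using assms by (rule poincare_seqs_subset)
  show "finite ((X \<rightarrow>\<^sub>E {1..card Y}) \<times> (Y \<rightarrow>\<^sub>E {1..card X}))"
    using assms by (intro finite_cartesian_product finite_PiE) auto
qed

text \<open>Pulling degrees back along bijections is injective and preserves all conditions.
  Exchanging the roles of the vertex sets turns the inequality into an equality.\<close>

lemma card_poincare_seqs_le:
  assumes fin: "finite X" "finite Y" "finite X'" "finite Y'"
    and card: "card X = card X'" "card Y = card Y'" and C: "C \<ge> 0" and r: "1 \<le> r"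
  shows "card (poincare_seqs C r X Y) \<le> card (poincare_seqs C r X' Y')"
proof -
  obtain \<alpha> \<beta> where ab: "bij_betw \<alpha> X' X" "bij_betw \<beta> Y' Y"
    using finite_same_card_bij[OF fin(3,1)] finite_same_card_bij[OF fin(4,2)] card by auto
  define \<Phi> where "\<Phi> = (\<lambda>(d, e). (restrict (d \<circ> \<alpha>) X' :: nat \<Rightarrow> nat, restrict (e \<circ> \<beta>) Y' :: nat \<Rightarrow> nat))"
  have img: "\<alpha> ` X' = X" "\<beta> ` Y' = Y" using ab by (auto simp: bij_betw_def)
  have "inj_on \<Phi> (poincare_seqs C r X Y)"
  proof (rule inj_onI, clarify)
    fix d e d' e'
    assume *: "(d, e) \<in> poincare_seqs C r X Y" "(d', e') \<in> poincare_seqs C r X Y" "\<Phi> (d, e) = \<Phi> (d', e')"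
    then have eq: "restrict (d \<circ> \<alpha>) X' = restrict (d' \<circ> \<alpha>) X'" "restrict (e \<circ> \<beta>) Y' = restrict (e' \<circ> \<beta>) Y'"
      by (auto simp: \<Phi>_def)
    have "d (\<alpha> x) = d' (\<alpha> x)" if "x \<in> X'" for x using fun_cong[OF eq(1), of x] that by simp
    moreover have "e (\<beta> y) = e' (\<beta> y)" if "y \<in> Y'" for y using fun_cong[OF eq(2), of y] that by simp
    ultimately show "d = d' \<and> e = e'"
      using * img by (auto simp: poincare_seqs_def intro!: extensionalityI)
  qed
  moreover have "\<Phi> ` poincare_seqs C r X Y \<subseteq> poincare_seqs C r X' Y'"
  proof (rule image_subsetI, clarify)
    fix d e assume de: "(d, e) \<in> poincare_seqs C r X Y"
    interpret relabelling X X' Y Y' "inv_into X' \<alpha>" "inv_into Y' \<beta>" d "restrict (d \<circ> \<alpha>) X'"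
      e "restrict (e \<circ> \<beta>) Y'"
    proof
      show "bij_betw (inv_into X' \<alpha>) X X'" "bij_betw (inv_into Y' \<beta>) Y Y'"
        using ab by (simp_all add: bij_betw_inv_into)
      show "restrict (d \<circ> \<alpha>) X' (inv_into X' \<alpha> x) = d x" if "x \<in> X" for x
        using that img inv_into_into[of x \<alpha> X'] f_inv_into_f[of x \<alpha> X'] by simp
      show "restrict (e \<circ> \<beta>) Y' (inv_into Y' \<beta> y) = e y" if "y \<in> Y" for y
        using that img inv_into_into[of y \<beta> Y'] f_inv_into_f[of y \<beta> Y'] by simp
    qed (use fin in auto)
    show "\<Phi> (d, e) \<in> poincare_seqs C r X' Y'"
      using de poincare_relabel[OF _ C] bij_betw_same_card[OF bij_betw_relabel] img
      by (auto simp: \<Phi>_def poincare_seqs_def)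
  qed
  ultimately show ?thesis
    using finite_poincare_seqs fin r by (intro card_inj_on_le) auto
qed

definition num_poincare_seqs :: "real \<Rightarrow> nat \<Rightarrow> nat \<Rightarrow> nat" where
  "num_poincare_seqs C r n = card (poincare_seqs C r {..<n} {..<n})"

lemma card_poincare_seqs:
  assumes "finite X" "finite Y" "card X = n" "card Y = n" "C \<ge> 0" "1 \<le> r"
  shows "card (poincare_seqs C r X Y) = num_poincare_seqs C r n"
  unfolding num_poincare_seqs_def using assms by (intro antisym card_poincare_seqs_le) auto


text \<open>All degrees of a block are positive, so the thresholds \<open>b\<close> and \<open>a\<close> separate the vertices of
  the two blocks and the blocks can be recovered from the composed degrees.\<close>

lemma num_poincare_seqs_add:
  assumes C: "C \<ge> 0" and r: "1 \<le> r" "1 \<le> s"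
  shows "((a + b) choose a)\<^sup>2 * (num_poincare_seqs C r a * num_poincare_seqs C s b) \<le> num_poincare_seqs C (r * s) (a + b)"
proof -
  define N where "N = {..<a + b}"
  define \<A> where "\<A> = {A. A \<subseteq> N \<and> card A = a}"
  have N: "finite N" "card N = a + b" by (auto simp: N_def)
  have A: "finite A" "finite (N - A)" "card A = a" "card (N - A) = b" "A \<inter> (N - A) = {}" "A \<union> (N - A) = N"
    if "A \<in> \<A>" for A
    using that N finite_subset[of A N] by (auto simp: \<A>_def card_Diff_subset)
  \<comment> \<open>A composition is determined by the positions of the first block in both classes,
    which gives the squared binomial coefficient, and by a sequence on each block.\<close>
  define D where "D = (SIGMA p:\<A> \<times> \<A>. poincare_seqs C r (fst p) (snd p) \<times> poincare_seqs C s (N - fst p) (N - snd p))"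
  define \<Phi> where "\<Phi> = (\<lambda>((A, B), (d1, e1), (d2, e2)).
    (restrict (\<lambda>x. if x \<in> A then d1 x + b else d2 x) N :: nat \<Rightarrow> nat,
     restrict (\<lambda>y. if y \<in> B then e1 y else e2 y + a) N :: nat \<Rightarrow> nat))"
  have "card D = (\<Sum>p\<in>\<A> \<times> \<A>. num_poincare_seqs C r a * num_poincare_seqs C s b)"
  proof -
    have "card (poincare_seqs C r (fst p) (snd p) \<times> poincare_seqs C s (N - fst p) (N - snd p)) =
        num_poincare_seqs C r a * num_poincare_seqs C s b" "finite (poincare_seqs C r (fst p) (snd p) \<times> poincare_seqs C s (N - fst p) (N - snd p))"
      if "p \<in> \<A> \<times> \<A>" for p
      using that A[of "fst p"] A[of "snd p"] C r
      by (auto simp: card_cartesian_product card_poincare_seqs mem_Times_iff intro!: finite_poincare_seqs)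
    moreover have "finite (\<A> \<times> \<A>)" using N by (auto simp: \<A>_def)
    ultimately show ?thesis unfolding D_def by (subst card_SigmaI) auto
  qed
  also have "\<dots> = ((a + b) choose a)\<^sup>2 * (num_poincare_seqs C r a * num_poincare_seqs C s b)"
    using n_subsets[OF N(1), of a] N by (simp add: card_cartesian_product power2_eq_square \<A>_def)
  finally have card_D: "card D = ((a + b) choose a)\<^sup>2 * (num_poincare_seqs C r a * num_poincare_seqs C s b)" .
  have "\<Phi> ` D \<subseteq> poincare_seqs C (r * s) N N"
  proof (rule image_subsetI)
    fix z assume "z \<in> D"
    then obtain A B d1 e1 d2 e2 where z: "z = ((A, B), (d1, e1), (d2, e2))" "A \<in> \<A>" "B \<in> \<A>"
      "(d1, e1) \<in> poincare_seqs C r A B" "(d2, e2) \<in> poincare_seqs C s (N - A) (N - B)"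
      by (auto simp: D_def)
    obtain d e where de: "\<Phi> z = (d, e)" by (cases "\<Phi> z") auto
    then have d_eq: "d = restrict (\<lambda>x. if x \<in> A then d1 x + b else d2 x) N"
      and e_eq: "e = restrict (\<lambda>y. if y \<in> B then e1 y else e2 y + a) N"
      by (auto simp: z \<Phi>_def)
    have sub: "A \<subseteq> N" "B \<subseteq> N" using z by (auto simp: \<A>_def)
    obtain G1 where "G1 \<in> marg_realizations A B d1 e1" using z(4) r(1) by (rule poincare_seqs_realization)
    then interpret composition A "N - A" B "N - B" d1 e1 d2 e2 d e
      using A[OF z(2)] A[OF z(3)] sub by unfold_locales (auto simp: d_eq e_eq)
    have Un: "A \<union> (N - A) = N" "B \<union> (N - B) = N" using sub by auto
    have "card (marg_realizations N N d e) =
        card (marg_realizations A B d1 e1) * card (marg_realizations (N - A) (N - B) d2 e2)"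
      using bij_betw_same_card[OF bij_betw_composition] unfolding Un card_cartesian_product by simp
    moreover have "poincare C (marg_realizations N N d e)"
      using poincare_composition[OF _ _ C] z(4,5) unfolding Un poincare_seqs_def by simp
    moreover have "1 \<le> d x" "1 \<le> e x" if "x \<in> N" for x
      using that z(4,5) by (auto simp: d_eq e_eq poincare_seqs_def intro: trans_le_add1)
    ultimately show "\<Phi> z \<in> poincare_seqs C (r * s) N N"
      using z(4,5) by (auto simp: de poincare_seqs_def mult_le_mono d_eq e_eq)
  qed
  moreover have "inj_on \<Phi> D"
  proof (rule inj_onI)
    fix z z' assume "z \<in> D" "z' \<in> D" "\<Phi> z = \<Phi> z'"
    then obtain A B d1 e1 d2 e2 A' B' d1' e1' d2' e2'
      where z: "z = ((A, B), (d1, e1), (d2, e2))" "A \<in> \<A>" "B \<in> \<A>"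
      "(d1, e1) \<in> poincare_seqs C r A B" "(d2, e2) \<in> poincare_seqs C s (N - A) (N - B)"
      and z': "z' = ((A', B'), (d1', e1'), (d2', e2'))" "A' \<in> \<A>" "B' \<in> \<A>"
      "(d1', e1') \<in> poincare_seqs C r A' B'" "(d2', e2') \<in> poincare_seqs C s (N - A') (N - B')"
      by (auto simp: D_def)
    have "restrict (\<lambda>x. if x \<in> A then d1 x + b else d2 x) N =
        restrict (\<lambda>x. if x \<in> A' then d1' x + b else d2' x) N"
      and "restrict (\<lambda>x. if x \<in> B then e1 x else e2 x + a) N =
        restrict (\<lambda>x. if x \<in> B' then e1' x else e2' x + a) N"
      using \<open>\<Phi> z = \<Phi> z'\<close> unfolding z(1) z'(1) \<Phi>_def by simp_all
    note eq = this[THEN fun_cong]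
    have d: "(if x \<in> A then d1 x + b else d2 x) = (if x \<in> A' then d1' x + b else d2' x)"
      and e: "(if x \<in> B then e1 x else e2 x + a) = (if x \<in> B' then e1' x else e2' x + a)"
      if "x \<in> N" for x
      using eq[of x] that by simp_all
    \<comment> \<open>In the first class, degrees are at least 1 + \<open>b\<close> on
      \<open>A\<close> and at most \<open>b\<close> elsewhere. In the second, they are at most
      \<open>a\<close> on \<open>B\<close> and at least 1 + \<open>a\<close> elsewhere. Positivity
      supplies both strict gaps.\<close>
    have threshold: "b < (if x \<in> A then d1 x + b else d2 x) \<longleftrightarrow> x \<in> A"
      "(if x \<in> B then e1 x else e2 x + a) \<le> a \<longleftrightarrow> x \<in> B"
      if x: "x \<in> N" and AB: "A \<in> \<A>" "B \<in> \<A>"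
        and g: "(d1, e1) \<in> poincare_seqs C r A B" "(d2, e2) \<in> poincare_seqs C s (N - A) (N - B)"
      for x A B d1 e1 d2 e2
    proof -
      note g1 = subsetD[OF poincare_seqs_subset[OF A(1)[OF AB(1)] A(1)[OF AB(2)] r(1)] g(1)]
      note g2 = subsetD[OF poincare_seqs_subset[OF A(2)[OF AB(1)] A(2)[OF AB(2)] r(2)] g(2)]
      have "x \<in> A \<Longrightarrow> 1 \<le> d1 x" "x \<notin> A \<Longrightarrow> d2 x \<le> b" "x \<in> B \<Longrightarrow> e1 x \<le> a" "x \<notin> B \<Longrightarrow> 1 \<le> e2 x"
        using g1 g2 x A[OF AB(1)] A[OF AB(2)] by (auto simp: PiE_iff)
      then show "b < (if x \<in> A then d1 x + b else d2 x) \<longleftrightarrow> x \<in> A"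
        "(if x \<in> B then e1 x else e2 x + a) \<le> a \<longleftrightarrow> x \<in> B" by auto
    qed
    have sub: "A \<subseteq> N" "B \<subseteq> N" "A' \<subseteq> N" "B' \<subseteq> N" using z z' by (auto simp: \<A>_def)
    have "x \<in> A \<longleftrightarrow> x \<in> A'" "x \<in> B \<longleftrightarrow> x \<in> B'" if "x \<in> N" for x
      using threshold[OF that z(2-5)] threshold[OF that z'(2-5)] unfolding d[OF that] e[OF that] by blast+
    then have AB: "A = A'" "B = B'" using sub by blast+
    have pointwise: "x \<in> A' \<Longrightarrow> d1 x = d1' x" "x \<in> N - A' \<Longrightarrow> d2 x = d2' x"
      "x \<in> B' \<Longrightarrow> e1 x = e1' x" "x \<in> N - B' \<Longrightarrow> e2 x = e2' x" for x
      using d[of x] e[of x] subsetD[OF sub(3), of x] subsetD[OF sub(4), of x] unfolding AB by auto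
    have "d1 = d1'" "e1 = e1'" "d2 = d2'" "e2 = e2'"
      using z(4,5) z'(4,5) pointwise unfolding AB poincare_seqs_def
      by (auto intro: extensionalityI[of d1 A'] extensionalityI[of e1 B']
        extensionalityI[of d2 "N - A'"] extensionalityI[of e2 "N - B'"])
    then show "z = z'" using AB by (simp add: z(1) z'(1))
  qed
  ultimately have "card D \<le> card (poincare_seqs C (r * s) N N)"
    using N(1) r by (intro card_inj_on_le) (auto intro!: finite_poincare_seqs simp: Suc_le_eq)
  then show ?thesis by (simp add: card_D num_poincare_seqs_def N_def)
qed

section \<open>The spectral gap of the swap chain\<close>

lemma proposals_card: "finite (proposals n)" "card (proposals n) \<le> n ^ 4"
proof -
  have sub: "proposals n \<subseteq> {..<n} \<times> {..<n} \<times> {..<n} \<times> {..<n}" by (auto simp: proposals_def)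
  then show "finite (proposals n)" by (rule finite_subset) simp
  have "card (proposals n) \<le> card ({..<n} \<times> {..<n} \<times> {..<n} \<times> {..<n})"
    using sub by (rule card_mono[rotated]) simp
  then show "card (proposals n) \<le> n ^ 4" by (simp add: card_cartesian_product power4_eq_xxxx mult_ac)
qed

lemma try_swap_reverse:
  assumes "try_swap G (a, b, c, d) = H" "G \<noteq> H"
  shows "try_swap H (b, a, c, d) = G"
proof -
  have *: "(a, c) \<in> G" "(b, d) \<in> G" "(b, c) \<notin> G" "(a, d) \<notin> G"
    "H = G - {(a, c), (b, d)} \<union> {(b, c), (a, d)}"
    using assms by (auto simp: try_swap_def split: if_splits)
  then have "(b, c) \<in> H" "(a, d) \<in> H" "(a, c) \<notin> H" "(b, d) \<notin> H" by auto
  moreover have "G = H - {(b, c), (a, d)} \<union> {(a, c), (b, d)}"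
    unfolding *(5) using *(1-4) by blast
  ultimately show ?thesis by (simp add: try_swap_def)
qed

lemma try_swap_imp_swap:
  assumes "try_swap G q = H" "G \<noteq> H"
  shows "swap G H"
proof -
  obtain a b c d where q: "q = (a, b, c, d)" by (cases q)
  show ?thesis
    by (rule swapI[of a c G b d]) (use assms q in \<open>auto simp: try_swap_def split: if_splits\<close>)
qed

lemma swap_imp_try_swap:
  assumes "swap G H" "G \<subseteq> {..<n} \<times> {..<n}"
  obtains q where "q \<in> proposals n" "try_swap G q = H"
  using assms(1)
proof (rule swapE)
  fix a b c d
  assume *: "(a, c) \<in> G" "(b, d) \<in> G" "(b, c) \<notin> G" "(a, d) \<notin> G"
    "H = G - {(a, c), (b, d)} \<union> {(b, c), (a, d)}" "a \<noteq> b" "c \<noteq> d"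
  show thesis
  proof (rule that)
    show "(a, b, c, d) \<in> proposals n" using * assms(2) by (auto simp: proposals_def)
    show "try_swap G (a, b, c, d) = H" using * by (simp add: try_swap_def)
  qed
qed

text \<open>Exchanging \<open>a\<close> and \<open>b\<close> in a proposal undoes its swap, so the
  proposals leading from \<open>G\<close> to \<open>H\<close> correspond to those leading
  back.\<close>

lemma swap_prob_sym: "swap_prob n G H = swap_prob n H G"
proof (cases "G = H")
  case False
  have "bij_betw (\<lambda>(a, b, c, d). (b, a, c, d))
      {q \<in> proposals n. try_swap G q = H} {q \<in> proposals n. try_swap H q = G}"
  proof (rule bij_betw_byWitness[where f' = "\<lambda>(a, b, c, d). (b, a, c, d)"])
    show "(\<lambda>(a, b, c, d). (b, a, c, d)) ` {q \<in> proposals n. try_swap G q = H}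
        \<subseteq> {q \<in> proposals n. try_swap H q = G}"
      using try_swap_reverse[OF _ False] by (auto simp: proposals_def)
    show "(\<lambda>(a, b, c, d). (b, a, c, d)) ` {q \<in> proposals n. try_swap H q = G}
        \<subseteq> {q \<in> proposals n. try_swap G q = H}"
      using try_swap_reverse[OF _ False[symmetric]] by (auto simp: proposals_def)
  qed auto
  then have "card {q \<in> proposals n. try_swap G q = H} = card {q \<in> proposals n. try_swap H q = G}"
    by (rule bij_betw_same_card)
  then show ?thesis using False by (simp add: swap_prob_def)
qed simp

lemma realizations_eq:
  "realizations n D = marg_realizations {..<n} {..<n} ((!) (fst D)) ((!) (snd D))"
  by (auto simp: realizations_def marg_realizations_def)

lemma swap_prob_sum:
  assumes "G \<in> realizations n D"
  shows "(\<Sum>H\<in>realizations n D. swap_prob n G H) = 1"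
proof -
  let ?S = "realizations n D"
  have fin: "finite ?S" by (simp add: realizations_eq marg_realizations_finite)
  have 1: "(\<Sum>H\<in>?S. of_bool (G = H)) = (1 :: real)"
    using fin assms by (simp add: of_bool_def)
  show ?thesis
  proof (cases "proposals n = {}")
    case True
    then show ?thesis using 1 by (simp add: swap_prob_def)
  next
    case False
    have "try_swap G q \<in> ?S" for q
    proof (cases "try_swap G q = G")
      case False
      then have "swap G (try_swap G q)" using try_swap_imp_swap by metis
      then show ?thesis using assms unfolding realizations_eq by (rule swap_marg_realizations) auto
    qed (use assms in simp)
    \<comment> \<open>Proposals are grouped by their outcome, which is always a realization
      again.\<close>
    then have "(\<Sum>H\<in>?S. \<Sum>q | q \<in> proposals n \<and> try_swap G q = H. 1) = (\<Sum>q\<in>proposals n. 1 :: real)"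
      using proposals_card(1) fin by (intro sum.group) auto
    then have 2: "(\<Sum>H\<in>?S. real (card {q \<in> proposals n. try_swap G q = H})) = card (proposals n)"
      by simp
    have "(\<Sum>H\<in>?S. swap_prob n G H) = 1 / 2 * (\<Sum>H\<in>?S. of_bool (G = H)) +
        1 / 2 * ((\<Sum>H\<in>?S. real (card {q \<in> proposals n. try_swap G q = H})) / card (proposals n))"
      using False by (simp add: swap_prob_def sum.distrib sum_divide_distrib mult.commute)
    then show ?thesis using False proposals_card(1)[of n] unfolding 1 2 by simp
  qed
qed

lemma swap_prob_nonneg: "0 \<le> swap_prob n G H"
  by (simp add: swap_prob_def)

text \<open>A single proposal performing the swap suffices: there are at most n^4 proposals, and
  laziness costs the factor 2.\<close>

lemma swap_prob_lower:
  assumes "swap G H" "G \<in> realizations n D"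
  shows "1 \<le> 2 * real n ^ 4 * swap_prob n G H"
proof -
  have "G \<subseteq> {..<n} \<times> {..<n}" using assms(2) by (simp add: realizations_def)
  with assms(1) obtain q where q: "q \<in> proposals n" "try_swap G q = H"
    by (rule swap_imp_try_swap)
  then have "{q \<in> proposals n. try_swap G q = H} \<noteq> {}" by blast
  then have c1: "1 \<le> card {q \<in> proposals n. try_swap G q = H}"
    using proposals_card(1)[of n] by (simp add: Suc_le_eq card_gt_0_iff)
  have pos: "0 < card (proposals n)" using q(1) proposals_card(1)[of n] by (auto simp: card_gt_0_iff)
  have "real (card (proposals n)) \<le> real (n ^ 4)" using proposals_card(2) by (simp only: of_nat_le_iff)
  then have c2: "real (card (proposals n)) \<le> real n ^ 4" by simp
  have "1 = real (card (proposals n)) * (1 / card (proposals n))" using pos by simp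
  also have "\<dots> \<le> real n ^ 4 * (card {q \<in> proposals n. try_swap G q = H} / card (proposals n))"
    using c1 c2 by (intro mult_mono divide_right_mono) auto
  also have "\<dots> \<le> real n ^ 4 * (2 * swap_prob n G H)"
    using q(1) by (intro mult_left_mono) (auto simp: swap_prob_def)
  finally show ?thesis by simp
qed

text \<open>Bounding each swap indicator by 2 n^4 times the transition probability turns the
  combinatorial Poincare inequality into one for the transition matrix. For \<open>n = 0\<close>
  only the empty graph exists, so two states force \<open>n > 0\<close>.\<close>

lemma lambda2_bound:
  assumes P: "poincare C (realizations n D)" and C: "C > 0" and two: "2 \<le> card (realizations n D)"
  shows "1 \<le> 2 * C * real n ^ 4 * (1 - lambda2 n D)" and "n > 0"
proof -
  define S where "S = realizations n D"
  define N where "N = card S"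
  define g where "g = from_nat_into S"
  have fin: "finite S" by (simp add: S_def realizations_eq marg_realizations_finite)
  show "n > 0"
  proof (rule ccontr)
    assume "\<not> n > 0"
    then have "S \<subseteq> {{}}" by (auto simp: S_def realizations_def)
    then have "card S \<le> card {{} :: bigraph}" by (intro card_mono) auto
    then show False using two by (simp add: S_def)
  qed
  have g: "bij_betw g {..<N} S"
    unfolding g_def N_def using fin by (rule bij_betw_from_nat_into_finite)
  then have gS: "g i \<in> S" if "i < N" for i using that by (auto simp: bij_betw_def)
  have reindex: "(\<Sum>x\<in>S. h x) = (\<Sum>i<N. h (g i))" for h :: "bigraph \<Rightarrow> real"
    using sum.reindex_bij_betw[OF g, of h] by simp
  have M: "swap_matrix n D = mat N N (\<lambda>(i, j). swap_prob n (g i) (g j))"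
    by (simp add: swap_matrix_def S_def N_def g_def Let_def)
  show "1 \<le> 2 * C * real n ^ 4 * (1 - lambda2 n D)"
    unfolding lambda2_def
  proof (rule stochastic_second_eigenvalue[where N = N])
    show "swap_matrix n D \<in> carrier_mat N N" by (simp add: M)
    show "2 \<le> N" using two by (simp add: N_def S_def)
    show "swap_matrix n D $$ (i, j) = swap_matrix n D $$ (j, i)" if "i < N" "j < N" for i j
      using that by (simp add: M swap_prob_sym)
    show "(\<Sum>j<N. swap_matrix n D $$ (i, j)) = 1" if "i < N" for i
      using that reindex[of "swap_prob n (g i)"] swap_prob_sum[of "g i" n D] gS[of i]
      by (simp add: M S_def)
    show "0 < 2 * C * real n ^ 4" using C \<open>n > 0\<close> by simp
    fix f :: "nat \<Rightarrow> real"
    define F where "F x = f (inv_into {..<N} g x)" for x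
    have F: "F (g i) = f i" if "i < N" for i
      using that g by (simp add: F_def bij_betw_def)
    have "(\<Sum>i<N. \<Sum>j<N. (f i - f j)\<^sup>2) = (\<Sum>x\<in>S. \<Sum>y\<in>S. (F x - F y)\<^sup>2)"
      by (simp add: reindex F)
    also have "\<dots> \<le> C * N * (\<Sum>x\<in>S. \<Sum>y\<in>S. of_bool (swap x y) * (F x - F y)\<^sup>2)"
      using P by (simp add: poincare_def S_def N_def)
    also have "\<dots> \<le> C * N * (\<Sum>x\<in>S. \<Sum>y\<in>S. 2 * real n ^ 4 * swap_prob n x y * (F x - F y)\<^sup>2)"
    proof (intro mult_left_mono sum_mono mult_right_mono)
      fix x y assume "x \<in> S" "y \<in> S"
      then show "of_bool (swap x y) \<le> 2 * real n ^ 4 * swap_prob n x y"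
        using swap_prob_lower[of x y n D] swap_prob_nonneg[of n x y] by (auto simp: of_bool_def S_def)
    qed (use C in auto)
    also have "\<dots> = 2 * C * real n ^ 4 * N * (\<Sum>x\<in>S. \<Sum>y\<in>S. swap_prob n x y * (F x - F y)\<^sup>2)"
      by (simp add: sum_distrib_left mult_ac)
    also have "(\<Sum>x\<in>S. \<Sum>y\<in>S. swap_prob n x y * (F x - F y)\<^sup>2) =
        (\<Sum>i<N. \<Sum>j<N. swap_matrix n D $$ (i, j) * (f i - f j)\<^sup>2)"
      by (simp add: reindex F M)
    finally show "(\<Sum>i<N. \<Sum>j<N. (f i - f j)\<^sup>2) \<le> 2 * C * real n ^ 4 * N *
        (\<Sum>i<N. \<Sum>j<N. swap_matrix n D $$ (i, j) * (f i - f j)\<^sup>2)" .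
  qed
qed

section \<open>Counting\<close>

lemma finite_graphical: "finite {D. graphical n D}"
proof (rule finite_subset)
  let ?L = "{xs. set xs \<subseteq> {..n} \<and> length xs = n}"
  show "{D. graphical n D} \<subseteq> ?L \<times> ?L"
  proof
    fix D assume "D \<in> {D. graphical n D}"
    then obtain G where D: "length (fst D) = n" "length (snd D) = n" "G \<in> realizations n D"
      by (auto simp: graphical_def)
    then have "\<forall>i<n. fst D ! i \<le> n" "\<forall>i<n. snd D ! i \<le> n"
      using marg_realizations_le[of G "{..<n}" "{..<n}"] by (auto simp: realizations_eq)
    then show "D \<in> ?L \<times> ?L" using D(1,2) by (auto simp: mem_Times_iff in_set_conv_nth)
  qed
  show "finite (?L \<times> ?L)" by (intro finite_cartesian_product finite_lists_length_eq) auto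
qed

text \<open>The polynomial is 1 + 2C x^4. Its constant term makes the bound on the relaxation time
  strict.\<close>

lemma num_poincare_seqs_le_num_fast:
  assumes C: "C > 0"
  shows "num_poincare_seqs C 2 n \<le> num_fast [:1, 0, 0, 0, 2 * C:] n"
proof -
  define \<Phi> where "\<Phi> = (\<lambda>(d, e). (map d [0..<n], map e [0..<n]) :: bidegseq)"
  have "inj_on \<Phi> (poincare_seqs C 2 {..<n} {..<n})"
  proof (rule inj_onI, clarify)
    fix d e d' e'
    assume *: "(d, e) \<in> poincare_seqs C 2 {..<n} {..<n}" "(d', e') \<in> poincare_seqs C 2 {..<n} {..<n}" "\<Phi> (d, e) = \<Phi> (d', e')"
    then have "\<forall>i<n. d i = d' i" "\<forall>i<n. e i = e' i" by (auto simp: \<Phi>_def)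
    then show "d = d' \<and> e = e'" using *(1,2)
      by (auto simp: poincare_seqs_def intro: extensionalityI[of d "{..<n}"] extensionalityI[of e "{..<n}"])
  qed
  moreover have "\<Phi> ` poincare_seqs C 2 {..<n} {..<n} \<subseteq>
      {D. graphical n D \<and> relaxation_time_less n D (poly [:1, 0, 0, 0, 2 * C:] (real n))}"
  proof (rule image_subsetI, clarify)
    fix d e assume de: "(d, e) \<in> poincare_seqs C 2 {..<n} {..<n}"
    define D where "D = \<Phi> (d, e)"
    have R: "realizations n D = marg_realizations {..<n} {..<n} d e"
      unfolding realizations_eq by (intro marg_realizations_cong) (auto simp: D_def \<Phi>_def)
    have two: "2 \<le> card (realizations n D)" and P: "poincare C (realizations n D)"
      using de by (simp_all add: R poincare_seqs_def)
    have "realizations n D \<noteq> {}" using two by auto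
    then have gr: "graphical n D" by (simp add: graphical_def D_def \<Phi>_def)
    note l = lambda2_bound[OF P C two]
    define K where "K = 2 * C * real n ^ 4"
    have K: "K > 0" using C l(2) by (simp add: K_def)
    have "0 < K * (1 - lambda2 n D)" using l(1) unfolding K_def by linarith
    then have less1: "lambda2 n D < 1" using K by (simp add: zero_less_mult_iff)
    then have "1 / (1 - lambda2 n D) \<le> K" using l(1) by (simp add: divide_le_eq K_def)
    also have "\<dots> < poly [:1, 0, 0, 0, 2 * C:] (real n)"
      by (simp add: K_def power4_eq_xxxx algebra_simps)
    finally show "graphical n (\<Phi> (d, e)) \<and>
        relaxation_time_less n (\<Phi> (d, e)) (poly [:1, 0, 0, 0, 2 * C:] (real n))"
      using gr two less1 unfolding D_def[symmetric] relaxation_time_less_def by simp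
  qed
  ultimately show ?thesis
    unfolding num_poincare_seqs_def num_fast_def
    by (rule card_inj_on_le) (rule finite_subset[OF _ finite_graphical], auto)
qed

section \<open>Positive sequences and their relation to all graphical ones\<close>

definition positive_seqs :: "nat \<Rightarrow> ((nat \<Rightarrow> nat) \<times> (nat \<Rightarrow> nat)) set" where
  "positive_seqs n = {(d, e). d \<in> extensional {..<n} \<and> e \<in> extensional {..<n} \<and>
     (\<forall>x<n. 1 \<le> d x) \<and> (\<forall>y<n. 1 \<le> e y) \<and> marg_realizations {..<n} {..<n} d e \<noteq> {}}"

lemma positive_seqs_subset:
  "positive_seqs n \<subseteq> ({..<n} \<rightarrow>\<^sub>E {1..n}) \<times> ({..<n} \<rightarrow>\<^sub>E {1..n})"
proof clarify
  fix d e assume de: "(d, e) \<in> positive_seqs n"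
  then obtain G where "G \<in> marg_realizations {..<n} {..<n} d e" by (auto simp: positive_seqs_def)
  from marg_realizations_le[OF this]
  show "d \<in> {..<n} \<rightarrow>\<^sub>E {1..n} \<and> e \<in> {..<n} \<rightarrow>\<^sub>E {1..n}"
    using de by (auto simp: positive_seqs_def PiE_def)
qed

lemma finite_positive_seqs: "finite (positive_seqs n)"
  using positive_seqs_subset by (rule finite_subset) (intro finite_cartesian_product finite_PiE, auto)

lemma card_positive_seqs_le: "card (positive_seqs n) \<le> (n ^ n)\<^sup>2"
proof -
  have "card (positive_seqs n) \<le> card (({..<n} \<rightarrow>\<^sub>E {1..n}) \<times> ({..<n} \<rightarrow>\<^sub>E {1..n}))"
    using positive_seqs_subset
    by (rule card_mono[rotated]) (intro finite_cartesian_product finite_PiE, auto)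
  then show ?thesis by (simp add: card_cartesian_product card_PiE power2_eq_square)
qed

lemma poincare_marg_realizations:
  assumes "finite X" "finite Y"
  shows "\<exists>C. poincare C (marg_realizations X Y d e)"
proof (rule poincare_connected)
  show "finite (marg_realizations X Y d e)" using assms by (rule marg_realizations_finite)
  show "swap\<^sup>*\<^sup>* G H" if "G \<in> marg_realizations X Y d e" "H \<in> marg_realizations X Y d e" for G H
    using assms that by (rule swap_connected)
  show "H \<in> marg_realizations X Y d e" if "G \<in> marg_realizations X Y d e" "swap G H" for G H
    using that(2,1) assms by (rule swap_marg_realizations)
qed

lemma poincare_seqs_mono: "C \<le> C' \<Longrightarrow> poincare_seqs C r X Y \<subseteq> poincare_seqs C' r X Y"
  using poincare_mono by (auto simp: poincare_seqs_def)

lemma num_poincare_seqs_mono: "C \<le> C' \<Longrightarrow> 1 \<le> r \<Longrightarrow> num_poincare_seqs C r n \<le> num_poincare_seqs C' r n"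
  unfolding num_poincare_seqs_def by (intro card_mono finite_poincare_seqs poincare_seqs_mono) auto

text \<open>Every sequence has some Poincare constant by connectivity, and for fixed
  \<open>n\<close> there are finitely many sequences. The constant depends on \<open>n\<close>, so
  this is applied to blocks of fixed size only.\<close>

lemma positive_seqs_le: "\<exists>C. card (positive_seqs n) \<le> num_poincare_seqs C 1 n"
proof -
  define R where "R p = marg_realizations {..<n} {..<n} (fst p) (snd p)" for p
  have "\<exists>C. poincare C (R p)" for p unfolding R_def by (rule poincare_marg_realizations) auto
  then obtain c where c: "poincare (c p) (R p)" for p by metis
  \<comment> \<open>Any common upper bound would do; the absolute values make the sum one.\<close>
  define C where "C = (\<Sum>p\<in>positive_seqs n. \<bar>c p\<bar>)"
  have "c p \<le> C" if "p \<in> positive_seqs n" for p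
    using member_le_sum[OF that, of "\<lambda>p. \<bar>c p\<bar>"] finite_positive_seqs by (auto simp: C_def)
  then have P: "poincare C (R p)" if "p \<in> positive_seqs n" for p
    using that c poincare_mono by blast
  have "positive_seqs n \<subseteq> poincare_seqs C 1 {..<n} {..<n}"
  proof clarify
    fix d e assume de: "(d, e) \<in> positive_seqs n"
    then have "marg_realizations {..<n} {..<n} d e \<noteq> {}" by (simp add: positive_seqs_def)
    then have "1 \<le> card (marg_realizations {..<n} {..<n} d e)"
      by (simp add: Suc_le_eq card_gt_0_iff marg_realizations_finite)
    then show "(d, e) \<in> poincare_seqs C 1 {..<n} {..<n}"
      using de P[OF de] by (auto simp: poincare_seqs_def positive_seqs_def R_def)
  qed
  then show ?thesis unfolding num_poincare_seqs_def by (intro exI[of _ C] card_mono finite_poincare_seqs) auto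
qed

text \<open>Adding to each class a vertex \<open>n\<close> adjacent to every vertex of the other
  class, the two new ones included, raises the old degrees by 1 and gives the new vertices degree
  \<open>Suc n\<close>. The old degrees can be read off again.\<close>

lemma num_graphical_le: "num_graphical n \<le> card (positive_seqs (Suc n))"
proof -
  define ext where "ext xs = restrict (\<lambda>i. if i < n then Suc (xs ! i) else Suc n) {..<Suc n}" for xs
  define \<Phi> where "\<Phi> = (\<lambda>D :: bidegseq. (ext (fst D), ext (snd D)))"
  have ext_less: "i < n \<Longrightarrow> ext xs i = Suc (xs ! i)" and ext_n: "ext xs n = Suc n" for xs i
    by (simp_all add: ext_def)
  have "inj_on \<Phi> {D. graphical n D}"
  proof (rule inj_onI)
    fix D D' assume *: "D \<in> {D. graphical n D}" "D' \<in> {D. graphical n D}" "\<Phi> D = \<Phi> D'"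
    have "xs = ys" if "ext xs = ext ys" "length xs = n" "length ys = n" for xs ys
    proof (rule nth_equalityI)
      fix i assume "i < length xs"
      then have "Suc (xs ! i) = Suc (ys ! i)"
        using that ext_less[of i xs] ext_less[of i ys] by simp
      then show "xs ! i = ys ! i" by simp
    qed (use that in simp)
    then show "D = D'" using * by (auto simp: \<Phi>_def graphical_def prod_eq_iff)
  qed
  moreover have "\<Phi> ` {D. graphical n D} \<subseteq> positive_seqs (Suc n)"
  proof (rule image_subsetI)
    fix D assume "D \<in> {D. graphical n D}"
    then obtain G where G: "G \<in> realizations n D" by (auto simp: graphical_def)
    define H where "H = G \<union> {n} \<times> {..<Suc n} \<union> {..<Suc n} \<times> {n}"
    have sub: "G \<subseteq> {..<n} \<times> {..<n}" using G by (simp add: realizations_def)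
    have fin: "finite {y. (x, y) \<in> G}" "finite {y. (y, x) \<in> G}" for x
      using sub by (auto intro: finite_subset[of _ "{..<n}"])
    have "card {y. (x, y) \<in> H} = ext (fst D) x \<and> card {y. (y, x) \<in> H} = ext (snd D) x"
      if "x < Suc n" for x
    proof (cases "x < n")
      case True
      have "{y. (x, y) \<in> H} = insert n {y. (x, y) \<in> G}" "{y. (y, x) \<in> H} = insert n {y. (y, x) \<in> G}"
        using True by (auto simp: H_def)
      moreover have "n \<notin> {y. (x, y) \<in> G}" "n \<notin> {y. (y, x) \<in> G}" using sub by auto
      moreover have "card {y. (x, y) \<in> G} = fst D ! x" "card {y. (y, x) \<in> G} = snd D ! x"
        using G True by (auto simp: realizations_def)
      ultimately show ?thesis using True fin by (simp add: ext_less)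
    next
      case False
      then have "x = n" using that by simp
      moreover have "{y. (n, y) \<in> H} = {..<Suc n}" "{y. (y, n) \<in> H} = {..<Suc n}"
        using sub by (auto simp: H_def)
      ultimately show ?thesis by (simp add: ext_n)
    qed
    moreover have "H \<subseteq> {..<Suc n} \<times> {..<Suc n}" using sub by (auto simp: H_def)
    ultimately have "H \<in> marg_realizations {..<Suc n} {..<Suc n} (ext (fst D)) (ext (snd D))"
      by (simp add: marg_realizations_def)
    then show "\<Phi> D \<in> positive_seqs (Suc n)"
      by (auto simp: \<Phi>_def positive_seqs_def ext_def)
  qed
  ultimately show ?thesis
    unfolding num_graphical_def using finite_positive_seqs by (rule card_inj_on_le)
qed

lemma positive_seqs_1: "1 \<le> card (positive_seqs 1)"
proof -
  have "{(0, 0)} \<in> marg_realizations {..<1} {..<1} (restrict (\<lambda>_. 1) {..<1}) (restrict (\<lambda>_. 1) {..<1})"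
    by (auto simp: marg_realizations_def)
  then have "(restrict (\<lambda>_. 1) {..<1}, restrict (\<lambda>_. 1) {..<1}) \<in> positive_seqs 1"
    by (auto simp: positive_seqs_def)
  then have "positive_seqs 1 \<noteq> {}" by blast
  then show ?thesis using finite_positive_seqs[of 1] by (simp add: Suc_le_eq card_gt_0_iff)
qed

text \<open>With all degrees 1 on 2 + 2 vertices, the two perfect matchings are realizations. This
  is the block that secures a second state.\<close>

lemma num_poincare_seqs_2: "\<exists>C. 1 \<le> num_poincare_seqs C 2 2"
proof -
  define d where "d = restrict (\<lambda>_. 1 :: nat) {..<2 :: nat}"
  obtain C where C: "poincare C (marg_realizations {..<2} {..<2} d d)"
    using poincare_marg_realizations[of "{..<2}" "{..<2}" d d] by auto
  have "{(0, 0), (1, 1)} \<in> marg_realizations {..<2} {..<2} d d"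
    "{(0, 1), (1, 0)} \<in> marg_realizations {..<2} {..<2} d d"
    by (auto simp: marg_realizations_def d_def less_2_cases_iff Collect_conv_if)
  then have "card {{(0, 0), (1, 1)}, {(0, 1), (1, 0)} :: bigraph} \<le> card (marg_realizations {..<2} {..<2} d d)"
    by (intro card_mono marg_realizations_finite) auto
  moreover have "{(0, 0), (1, 1)} \<noteq> ({(0, 1), (1, 0)} :: bigraph)" by auto
  ultimately have "2 \<le> card (marg_realizations {..<2} {..<2} d d)" by simp
  then have "(d, d) \<in> poincare_seqs C 2 {..<2} {..<2}" using C by (auto simp: poincare_seqs_def d_def)
  then have "poincare_seqs C 2 {..<2} {..<2} \<noteq> {}" by blast
  then have "1 \<le> num_poincare_seqs C 2 2"
    unfolding num_poincare_seqs_def by (simp add: Suc_le_eq card_gt_0_iff finite_poincare_seqs)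
  then show ?thesis ..
qed

section \<open>Normalised counts and their exponential growth\<close>

definition density :: "real \<Rightarrow> nat \<Rightarrow> nat \<Rightarrow> real" where
  "density C r n = num_poincare_seqs C r n / (fact n)\<^sup>2"

lemma density_nonneg: "0 \<le> density C r n"
  by (simp add: density_def)

lemma density_add:
  assumes "C \<ge> 0" "1 \<le> r" "1 \<le> s"
  shows "density C r a * density C s b \<le> density C (r * s) (a + b)"
proof -
  have "real (((a + b) choose a)\<^sup>2 * (num_poincare_seqs C r a * num_poincare_seqs C s b)) \<le> real (num_poincare_seqs C (r * s) (a + b))"
    using num_poincare_seqs_add[OF assms] by (simp only: of_nat_le_iff)
  moreover have "real ((a + b) choose a) = fact (a + b) / (fact a * fact b)"
    by (simp add: binomial_fact)
  ultimately show ?thesis by (simp add: density_def field_simps)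
qed

text \<open>The repeated block contributes the factor 1 to the number of realizations, so the bound
  \<open>s\<close> of the single initial block survives.\<close>

lemma density_power:
  assumes "C \<ge> 0" "1 \<le> s"
  shows "density C s a * density C 1 k ^ m \<le> density C s (a + k * m)"
proof (induction m)
  case (Suc m)
  have "density C s a * density C 1 k ^ Suc m = (density C s a * density C 1 k ^ m) * density C 1 k"
    by simp
  also have "\<dots> \<le> density C s (a + k * m) * density C 1 k"
    using Suc by (rule mult_right_mono) (rule density_nonneg)
  also have "\<dots> \<le> density C (s * 1) (a + k * m + k)"
    using assms by (intro density_add) auto
  finally show ?case by (simp add: algebra_simps)
qed simp

text \<open>n^n / n! is one term of the exponential series at n.\<close>

lemma power_le_fact_exp: "real n ^ n \<le> fact n * exp (real n)"
proof -
  have "(\<lambda>k. real n ^ k /\<^sub>R fact k) sums exp (real n)" by (rule exp_converges)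
  then have "(\<Sum>k\<in>{n}. real n ^ k /\<^sub>R fact k) \<le> exp (real n)"
    by (subst sums_unique, assumption, intro sum_le_suminf) (auto simp: sums_iff)
  then show ?thesis by (simp add: field_simps)
qed

theorem theorem5p11:
  assumes "log_convex_seq (\<lambda>n. real (num_graphical n))"
  shows "\<forall>\<epsilon>::real. \<epsilon> > 0 \<longrightarrow> (\<exists>p :: real poly.
           (\<forall>\<^sub>F n in at_top. num_fast p n > 0) \<and>
           (\<lambda>n. real (num_graphical n) / real (num_fast p n)) \<in> O(\<lambda>n. (1 + \<epsilon>) ^ n))"
proof (intro allI impI)
  fix \<epsilon> :: real assume \<epsilon>: "\<epsilon> > 0"
  \<comment> \<open>Since (1 + \<delta>)^3 \<le> 1 + 7 \<delta> for \<delta> \<le> 1, three losses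
    of (1 + \<delta>)^n are affordable: one for the block size, two for the factor (n+1)^2.\<close>
  define \<delta> where "\<delta> = min 1 (\<epsilon> / 7)"
  have \<delta>: "0 < \<delta>" "\<delta> \<le> 1" "\<delta> \<le> \<epsilon> / 7" using \<epsilon> by (auto simp: \<delta>_def)
  have \<delta>3: "(1 + \<delta>) ^ 3 \<le> 1 + \<epsilon>"
  proof -
    have d2: "\<delta> * \<delta> \<le> \<delta>" using \<delta> mult_left_le[of \<delta> \<delta>] by simp
    moreover have "\<delta> * (\<delta> * \<delta>) \<le> \<delta>" using mult_left_mono[OF d2, of \<delta>] d2 \<delta> by linarith
    ultimately have "1 + 3 * \<delta> + 3 * (\<delta> * \<delta>) + \<delta> * (\<delta> * \<delta>) \<le> 1 + \<epsilon>" using \<delta> by linarith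
    then show ?thesis by (simp add: power3_eq_cube algebra_simps)
  qed
  define F where "F n = card (positive_seqs n) / (fact n)\<^sup>2" for n
  have F_nonneg: "0 \<le> F n" for n by (simp add: F_def)
  have root_le: "root n (F n) \<le> exp 2" if "n \<ge> 1" for n
  proof -
    have "real (card (positive_seqs n)) \<le> (real n ^ n)\<^sup>2"
      using card_positive_seqs_le[of n] by (metis of_nat_le_iff of_nat_power)
    also have "\<dots> \<le> (fact n * exp (real n))\<^sup>2"
      by (intro power_mono power_le_fact_exp) simp
    also have "\<dots> = (fact n)\<^sup>2 * exp 2 ^ n"
      by (simp add: power_mult_distrib power2_eq_square[of "exp _"] mult_2_right flip: exp_add exp_of_nat_mult)
    finally have "F n \<le> exp 2 ^ n" by (simp add: F_def field_simps)
    then have "root n (F n) \<le> root n (exp 2 ^ n)" using that by simp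
    then show ?thesis using that by (simp add: real_root_power_cancel)
  qed
  \<comment> \<open>A supremum rather than a limit gives F n \<le> L^n for every n \<ge> 1, and a
    single size \<open>k\<close> that comes within the factor 1 + \<delta>.\<close>
  define L where "L = (SUP n\<in>{1..}. root n (F n))"
  have bdd: "bdd_above ((\<lambda>n. root n (F n)) ` {1..})"
    using root_le by (intro bdd_aboveI[of _ "exp 2"]) auto
  have root_le_L: "root n (F n) \<le> L" if "n \<ge> 1" for n
    unfolding L_def using that by (intro cSUP_upper bdd) auto
  have F_le: "F n \<le> L ^ n" if "n \<ge> 1" for n
  proof -
    have "F n = root n (F n) ^ n" using that F_nonneg by simp
    also have "\<dots> \<le> L ^ n" using root_le_L[OF that] F_nonneg that by (intro power_mono) auto
    finally show ?thesis .
  qed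
  have F1: "1 \<le> F 1" using positive_seqs_1 by (simp add: F_def)
  then have L: "1 \<le> L" using F_le[of 1] by simp
  have "L / (1 + \<delta>) < L" using L \<delta> by (simp add: divide_less_eq)
  then obtain k where k: "k \<ge> 1" "L / (1 + \<delta>) < root k (F k)"
    unfolding L_def by (subst (asm) less_cSUP_iff[OF _ bdd]) auto
  have Fk: "(L / (1 + \<delta>)) ^ k \<le> F k"
  proof -
    have "(L / (1 + \<delta>)) ^ k \<le> root k (F k) ^ k" using k L \<delta> by (intro power_mono) auto
    then show ?thesis using k F_nonneg by simp
  qed
  obtain C1 where C1: "card (positive_seqs k) \<le> num_poincare_seqs C1 1 k" using positive_seqs_le by blast
  obtain C2 where C2: "card (positive_seqs 1) \<le> num_poincare_seqs C2 1 1" using positive_seqs_le by blast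
  obtain C3 where C3: "1 \<le> num_poincare_seqs C3 2 2" using num_poincare_seqs_2 by blast
  \<comment> \<open>One constant for the three kinds of blocks, of sizes \<open>k\<close>, 1 and 2.
    It does not depend on \<open>n\<close>; the entry 1 makes it positive.\<close>
  define C where "C = Max {1, C1, C2, C3}"
  have C: "C > 0" "C1 \<le> C" "C2 \<le> C" "C3 \<le> C"
    by (auto simp: C_def less_max_iff_disj)
  have D1: "F k \<le> density C 1 k"
  proof -
    have "card (positive_seqs k) \<le> num_poincare_seqs C 1 k"
      using C1 num_poincare_seqs_mono[OF C(2), of 1 k] by linarith
    then show ?thesis unfolding F_def density_def by (intro divide_right_mono) auto
  qed
  have D2: "1 \<le> density C 1 1"
  proof -
    have "1 \<le> num_poincare_seqs C 1 1"
      using positive_seqs_1 C2 num_poincare_seqs_mono[OF C(3), of 1 1] by linarith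
    then show ?thesis unfolding density_def by simp
  qed
  \<comment> \<open>The denominator is the normalisation (2!)^2.\<close>
  have D3: "1 / 4 \<le> density C 2 2"
  proof -
    have "1 \<le> num_poincare_seqs C 2 2"
      using C3 num_poincare_seqs_mono[OF C(4), of 2 2] by linarith
    then show ?thesis unfolding density_def by simp
  qed
  define p where "p = [:1, 0, 0, 0, 2 * C:]"
  have lower: "L ^ (n - 2 - k) / (4 * (1 + \<delta>) ^ n) * (fact n)\<^sup>2 \<le> num_fast p n" if n: "n \<ge> k + 2" for n
  proof -
    \<comment> \<open>The n vertices of each class split into one block of size 2, \<open>m\<close>
      blocks of size \<open>k\<close> and \<open>r\<close> blocks of size 1. At most
      \<open>k\<close> vertices fall outside the first two kinds, hence the exponent
      \<open>n - 2 - k\<close>.\<close>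
    define m where "m = (n - 2) div k"
    define r where "r = (n - 2) mod k"
    have n_eq: "n = 2 + k * m + 1 * r" using n by (simp add: m_def r_def)
    have "r < k" using k by (simp add: r_def)
    then have km: "n - 2 - k \<le> k * m" "k * m \<le> n" using n_eq by linarith+
    have "L ^ (n - 2 - k) / (4 * (1 + \<delta>) ^ n) \<le> 1 / 4 * (L ^ (k * m) / (1 + \<delta>) ^ (k * m))"
      using L \<delta> km by (simp add: frac_le power_increasing)
    also have "L ^ (k * m) / (1 + \<delta>) ^ (k * m) = ((L / (1 + \<delta>)) ^ k) ^ m"
      by (simp add: power_mult power_divide)
    also have "1 / 4 * \<dots> \<le> density C 2 2 * density C 1 k ^ m"
      using D3 Fk D1 L \<delta> by (intro mult_mono power_mono) auto
    also have "\<dots> \<le> density C 2 (2 + k * m)"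
      using C by (intro density_power) auto
    \<comment> \<open>Blocks of size 1 have density at least 1, so filling up with them loses
      nothing.\<close>
    also have "\<dots> \<le> density C 2 (2 + k * m) * density C 1 1 ^ r"
      using mult_left_mono[OF one_le_power[OF D2, of r], of "density C 2 (2 + k * m)"]
      by (simp add: density_nonneg)
    also have "\<dots> \<le> density C 2 n"
      unfolding n_eq using C by (intro density_power) auto
    finally have "L ^ (n - 2 - k) / (4 * (1 + \<delta>) ^ n) * (fact n)\<^sup>2 \<le> density C 2 n * (fact n)\<^sup>2"
      by (rule mult_right_mono) simp
    also have "\<dots> = num_poincare_seqs C 2 n" by (simp add: density_def)
    also have "\<dots> \<le> num_fast p n" using num_poincare_seqs_le_num_fast[OF C(1), of n] by (simp add: p_def)
    finally show ?thesis .
  qed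
  have pos: "0 < L ^ (n - 2 - k) / (4 * (1 + \<delta>) ^ n) * (fact n)\<^sup>2" for n
    using L \<delta> by simp
  \<comment> \<open>This rules out that the quotient in the asymptotic bound is 0 merely by the
    convention for division by zero.\<close>
  have fast_pos: "0 < num_fast p n" if "n \<ge> k + 2" for n
    using lower[OF that] pos[of n] by (metis less_le_trans of_nat_0_less_iff)
  have bound: "real (num_graphical n) / num_fast p n \<le> (4 * L ^ (k + 3) / \<delta>\<^sup>2) * (1 + \<epsilon>) ^ n"
    if n: "n \<ge> k + 2" for n
  proof -
    have "real (num_graphical n) \<le> card (positive_seqs (Suc n))" using num_graphical_le by simp
    also have "\<dots> = F (Suc n) * (fact (Suc n))\<^sup>2" by (simp add: F_def)
    also have "\<dots> \<le> L ^ Suc n * (fact (Suc n))\<^sup>2" by (intro mult_right_mono F_le) auto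
    \<comment> \<open>The exponent n + 1 is split so that the power of \<open>L\<close> from
      \<open>lower\<close> cancels; what remains, \<open>L ^ (k + 3)\<close>, is constant in
      \<open>n\<close>.\<close>
    also have "\<dots> = L ^ (k + 3) * L ^ (n - 2 - k) * (real n + 1)\<^sup>2 * (fact n)\<^sup>2"
      using n by (simp add: power_mult_distrib add.commute flip: power_add)
    finally have upper: "real (num_graphical n) \<le> L ^ (k + 3) * L ^ (n - 2 - k) * (real n + 1)\<^sup>2 * (fact n)\<^sup>2" .
    \<comment> \<open>Bernoulli's inequality bounds n + 1 by (1 + \<delta>)^n / \<delta>, so the
      polynomial factor costs two of the three powers.\<close>
    have "\<delta> * (real n + 1) \<le> 1 + real n * \<delta>" using \<delta> by (simp add: algebra_simps)
    also have "\<dots> \<le> (1 + \<delta>) ^ n" using Bernoulli_inequality[of \<delta> n] \<delta> by simp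
    finally have "(\<delta> * (real n + 1))\<^sup>2 \<le> ((1 + \<delta>) ^ n)\<^sup>2" using \<delta> by (intro power_mono) auto
    then have n1: "(real n + 1)\<^sup>2 \<le> ((1 + \<delta>) ^ n)\<^sup>2 / \<delta>\<^sup>2"
      using \<delta> by (simp add: power_mult_distrib pos_le_divide_eq mult.commute)
    have "real (num_graphical n) / num_fast p n \<le>
        (L ^ (k + 3) * L ^ (n - 2 - k) * (real n + 1)\<^sup>2 * (fact n)\<^sup>2) /
        (L ^ (n - 2 - k) / (4 * (1 + \<delta>) ^ n) * (fact n)\<^sup>2)"
      using upper lower[OF n] pos L by (intro frac_le) auto
    also have "\<dots> = 4 * L ^ (k + 3) * (1 + \<delta>) ^ n * (real n + 1)\<^sup>2"
      using L \<delta> by (simp add: field_simps)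
    also have "\<dots> \<le> 4 * L ^ (k + 3) * (1 + \<delta>) ^ n * (((1 + \<delta>) ^ n)\<^sup>2 / \<delta>\<^sup>2)"
      using n1 L \<delta> by (intro mult_left_mono) auto
    also have "\<dots> = (4 * L ^ (k + 3) / \<delta>\<^sup>2) * ((1 + \<delta>) ^ 3) ^ n"
      by (simp add: power2_eq_square power3_eq_cube power_mult_distrib)
    also have "\<dots> \<le> (4 * L ^ (k + 3) / \<delta>\<^sup>2) * (1 + \<epsilon>) ^ n"
      using \<delta>3 L \<delta> by (intro mult_left_mono power_mono) auto
    finally show ?thesis .
  qed
  show "\<exists>p :: real poly. (\<forall>\<^sub>F n in at_top. num_fast p n > 0) \<and>
      (\<lambda>n. real (num_graphical n) / real (num_fast p n)) \<in> O(\<lambda>n. (1 + \<epsilon>) ^ n)"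
  proof (intro exI conjI)
    show "\<forall>\<^sub>F n in at_top. num_fast p n > 0"
      using fast_pos by (auto simp: eventually_at_top_linorder)
    show "(\<lambda>n. real (num_graphical n) / real (num_fast p n)) \<in> O(\<lambda>n. (1 + \<epsilon>) ^ n)"
      using bound \<epsilon>
      by (intro bigoI[of _ "4 * L ^ (k + 3) / \<delta>\<^sup>2"])
        (auto simp: eventually_at_top_linorder intro!: exI[of _ "k + 2"])
  qed
qed

end
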